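(* Let $(M,\langle\cdot,\cdot\rangle)$ be a Riemannian manifold, let $\mathcal M=\mathrm{Imm}([0,1],M)$, and let $G$ be a reparameterization-invariant Riemannian metric on $\mathcal M$. Let $s\mapsto c(s)$, $s\in[0,1]$, be a path in $\mathcal M$, and write the vertical part of its speed vector as $c_s(s)^{ver}=m(s)\cdot v(s)$, where $v(s,t)=c_t(s,t)/|c_t(s,t)|$ and $m(s):[0,1]\to\mathbb R$, $t\mapsto m(s,t)$, is the (real-valued) vertical component of $c_s(s)$. Then the horizontal part of $c$ with respect to $G$ is given by $$c^{hor}(s,t)=c\big(s,\varphi(s)^{-1}(t)\big),$$ where the path of diffeomorphisms $s\mapsto\varphi(s)=\varphi(s,\cdot)\in\mathrm{Diff}^+([0,1])$ is solution of the PDE $$\varphi_s(s,t)=\frac{m(s,t)}{|c_t(s,t)|}\,\varphi_t(s,t),$$ with initial condition $\varphi(0,\cdot)=\mathrm{Id}$.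
   Context: $\mathcal M=\mathrm{Imm}([0,1],M)=\{c\in C^\infty([0,1],M): c'(t)\neq 0\ \forall t\in[0,1]\}$ is an open submanifold of the Fréchet manifold $C^\infty([0,1],M)$, with tangent space $T_c\mathcal M=\{w\in C^\infty([0,1],TM): w(t)\in T_{c(t)}M\ \forall t\}$. $\mathrm{Diff}^+([0,1])$ is the group of increasing diffeomorphisms of $[0,1]$, acting on $\mathcal M$ by $c\mapsto c\circ\varphi$. A Riemannian metric $G$ on $\mathcal M$ (with $G_c:T_c\mathcal M\times T_c\mathcal M\to\mathbb R$) is reparameterization-invariant if $G_{c\circ\varphi}(w\circ\varphi,z\circ\varphi)=G_c(w,z)$ for all $c\in\mathcal M$, $w,z\in T_c\mathcal M$, $\varphi\in\mathrm{Diff}^+([0,1])$. Vertical and horizontal subspaces: with $v:=c'/|c'|$, $\mathrm{Ver}_c=\{mv: m\in C^\infty([0,1],\mathbb R),\ m(0)=m(1)=0\}$ and $\mathrm{Hor}_c=\{h\in T_c\mathcal M: G_c(h,mv)=0\ \ \forall m\in C^\infty([0,1],\mathbb R)\text{ with } m(0)=m(1)=0\}$. It is a standing assumption that $T_c\mathcal M=\mathrm{Ver}_c\oplus\mathrm{Hor}_c$ for every $c\in\mathcal M$; accordingly $w=w^{ver}+w^{hor}$ for $w\in T_c\mathcal M$. A path of curves $s\mapsto c(s)$ is identified with a smooth function $(s,t)\mapsto c(s,t)\in M$ on $[0,1]\times[0,1]$; subscripts $s$ and $t$ denote partial derivatives, e.g. $c_s=\partial c/\partial s$, $c_t=\partial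 c/\partial t$. Horizontal part of a path: a path of curves $c$ is decomposed as $c(s,t)=c^{hor}(s,\varphi(s,t))$ for all $s,t\in[0,1]$, where $s\mapsto\varphi(s)=\varphi(s,\cdot)\in\mathrm{Diff}^+([0,1])$ is a path of diffeomorphisms and $c^{hor}$ is a path in $\mathcal M$ that is horizontal, i.e. $c^{hor}_s(s)\in\mathrm{Hor}_{c^{hor}(s)}$ for all $s$. It is a standing assumption that such a decomposition exists; it is normalized by $\varphi(0)=\mathrm{Id}$, i.e. $c^{hor}(0)=c(0)$. The path $c^{hor}$ is called the horizontal part of $c$ with respect to $G$. *)

theory Defs
  imports "HOL-Analysis.Analysis"
begin

section \<open>Smooth maps between subsets of normed spaces\<close>

text \<open>
  Derivatives are taken within \<open>S\<close>, hence one-sided at boundary points. The notion is only used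
  where these derivatives are unique: for open sets, for \<open>[0,1]\<close>, \<open>[0,1] \<times> [0,1]\<close> and
  \<open>\<real> \<times> [0,1]\<close>, and for relatively open subsets of these.
\<close>

primrec Ck_on :: "nat \<Rightarrow> ('a::real_normed_vector \<Rightarrow> 'b::real_normed_vector) \<Rightarrow> 'a set \<Rightarrow> bool" where
  "Ck_on 0 f S \<longleftrightarrow> continuous_on S f"
| "Ck_on (Suc k) f S \<longleftrightarrow>
     (\<exists>f'. (\<forall>x\<in>S. (f has_derivative f' x) (at x within S)) \<and> (\<forall>v. Ck_on k (\<lambda>x. f' x v) S))"

definition smooth_on :: "'a::real_normed_vector set \<Rightarrow> ('a \<Rightarrow> 'b::real_normed_vector) \<Rightarrow> bool" where
  "smooth_on S f \<longleftrightarrow> (\<forall>k. Ck_on k f S)"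

abbreviation I01 :: "real set" where
  "I01 \<equiv> {0..1}"


section \<open>Smooth manifolds and tangent vectors\<close>

text \<open>
  The manifold is the whole type \<open>'a\<close>, of dimension \<open>DIM('e)\<close>. A chart is a pair of its domain and
  its coordinate map.
\<close>

type_synonym ('a, 'e) chart = "'a set \<times> ('a \<Rightarrow> 'e)"

abbreviation chart_dom :: "('a, 'e) chart \<Rightarrow> 'a set" where
  "chart_dom \<equiv> fst"

abbreviation chart_map :: "('a, 'e) chart \<Rightarrow> 'a \<Rightarrow> 'e" where
  "chart_map \<equiv> snd"

definition chart_inv :: "('a, 'e) chart \<Rightarrow> 'e \<Rightarrow> 'a" where
  "chart_inv \<kappa> = inv_into (chart_dom \<kappa>) (chart_map \<kappa>)"

definition smooth_atlas ::
    "('a::{t2_space, second_countable_topology}, 'e::euclidean_space) chart set \<Rightarrow> bool" where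
  "smooth_atlas A \<longleftrightarrow>
     (\<Union>\<kappa>\<in>A. chart_dom \<kappa>) = UNIV \<and>
     (\<forall>\<kappa>\<in>A. open (chart_dom \<kappa>) \<and> open (chart_map \<kappa> ` chart_dom \<kappa>) \<and>
        homeomorphism (chart_dom \<kappa>) (chart_map \<kappa> ` chart_dom \<kappa>) (chart_map \<kappa>) (chart_inv \<kappa>)) \<and>
     (\<forall>\<kappa>\<in>A. \<forall>\<psi>\<in>A.
        smooth_on (chart_map \<kappa> ` (chart_dom \<kappa> \<inter> chart_dom \<psi>)) (chart_map \<psi> \<circ> chart_inv \<kappa>))"

text \<open>
  A tangent vector at \<open>p\<close> is the family of its components in all charts around \<open>p\<close>, related by the
  differentials of the transition maps. The value at all other arguments is set to \<open>0\<close>, so that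
  equality of tangent vectors at \<open>p\<close> is equality of functions.
\<close>

type_synonym ('a, 'e) tvec = "('a, 'e) chart \<Rightarrow> 'e"

definition tzero :: "('a, 'e::real_vector) tvec" where
  "tzero = (\<lambda>\<kappa>. 0)"

definition tadd :: "('a, 'e::real_vector) tvec \<Rightarrow> ('a, 'e) tvec \<Rightarrow> ('a, 'e) tvec" (infixl "+\<^sub>T" 65) where
  "u +\<^sub>T v = (\<lambda>\<kappa>. u \<kappa> + v \<kappa>)"

definition tscale :: "real \<Rightarrow> ('a, 'e::real_vector) tvec \<Rightarrow> ('a, 'e) tvec" (infixr "*\<^sub>T" 75) where
  "r *\<^sub>T v = (\<lambda>\<kappa>. r *\<^sub>R v \<kappa>)"

definition tangent_space ::
    "('a, 'e::euclidean_space) chart set \<Rightarrow> 'a \<Rightarrow> ('a, 'e) tvec set" where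
  "tangent_space A p = {v.
     (\<forall>\<kappa>. \<not> (\<kappa> \<in> A \<and> p \<in> chart_dom \<kappa>) \<longrightarrow> v \<kappa> = 0) \<and>
     (\<forall>\<kappa>\<in>A. \<forall>\<psi>\<in>A. p \<in> chart_dom \<kappa> \<and> p \<in> chart_dom \<psi> \<longrightarrow>
        v \<psi> = frechet_derivative (chart_map \<psi> \<circ> chart_inv \<kappa>) (at (chart_map \<kappa> p)) (v \<kappa>))}"

text \<open>The tangent vector at \<open>p\<close> whose component in the chart \<open>\<kappa>\<close> is \<open>u\<close>.\<close>

definition chart_vector ::
    "('a, 'e::euclidean_space) chart set \<Rightarrow> ('a, 'e) chart \<Rightarrow> 'a \<Rightarrow> 'e \<Rightarrow> ('a, 'e) tvec" where
  "chart_vector A \<kappa> p u = (\<lambda>\<psi>. if \<psi> \<in> A \<and> p \<in> chart_dom \<psi>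
     then frechet_derivative (chart_map \<psi> \<circ> chart_inv \<kappa>) (at (chart_map \<kappa> p)) u else 0)"

definition riemannian_manifold ::
    "('a::{t2_space, second_countable_topology}, 'e::euclidean_space) chart set
      \<Rightarrow> ('a \<Rightarrow> ('a, 'e) tvec \<Rightarrow> ('a, 'e) tvec \<Rightarrow> real) \<Rightarrow> bool" where
  "riemannian_manifold A g \<longleftrightarrow>
     smooth_atlas A \<and>
     (\<forall>p. \<forall>u\<in>tangent_space A p. \<forall>v\<in>tangent_space A p. g p u v = g p v u) \<and>
     (\<forall>p. \<forall>u\<in>tangent_space A p. \<forall>v\<in>tangent_space A p. \<forall>w\<in>tangent_space A p. \<forall>r.
        g p (r *\<^sub>T u +\<^sub>T v) w = r * g p u w + g p v w) \<and>
     (\<forall>p. \<forall>u\<in>tangent_space A p. u \<noteq> tzero \<longrightarrow> g p u u > 0) \<and>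
     (\<forall>\<kappa>\<in>A. \<forall>u v. smooth_on (chart_map \<kappa> ` chart_dom \<kappa>)
        (\<lambda>x. g (chart_inv \<kappa> x) (chart_vector A \<kappa> (chart_inv \<kappa> x) u) (chart_vector A \<kappa> (chart_inv \<kappa> x) v)))"

definition tnorm ::
    "('a \<Rightarrow> ('a, 'e) tvec \<Rightarrow> ('a, 'e) tvec \<Rightarrow> real) \<Rightarrow> 'a \<Rightarrow> ('a, 'e) tvec \<Rightarrow> real" where
  "tnorm g p v = sqrt (g p v v)"


section \<open>Curves, vector fields along curves, paths of curves\<close>

definition smooth_map ::
    "('a::topological_space, 'e::euclidean_space) chart set \<Rightarrow> 'p::real_normed_vector set \<Rightarrow> ('p \<Rightarrow> 'a) \<Rightarrow> bool" where
  "smooth_map A S f \<longleftrightarrow> continuous_on S f \<and>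
     (\<forall>\<kappa>\<in>A. smooth_on (S \<inter> f -` chart_dom \<kappa>) (\<lambda>x. chart_map \<kappa> (f x)))"

definition smooth_field_along ::
    "('a, 'e::euclidean_space) chart set \<Rightarrow> 'p::real_normed_vector set
      \<Rightarrow> ('p \<Rightarrow> 'a) \<Rightarrow> ('p \<Rightarrow> ('a, 'e) tvec) \<Rightarrow> bool" where
  "smooth_field_along A S f w \<longleftrightarrow>
     (\<forall>x\<in>S. w x \<in> tangent_space A (f x)) \<and>
     (\<forall>\<kappa>\<in>A. smooth_on (S \<inter> f -` chart_dom \<kappa>) (\<lambda>x. w x \<kappa>))"

definition velocity ::
    "('a, 'e::euclidean_space) chart set \<Rightarrow> (real \<Rightarrow> 'a) \<Rightarrow> real \<Rightarrow> ('a, 'e) tvec" where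
  "velocity A c t = (\<lambda>\<kappa>. if \<kappa> \<in> A \<and> c t \<in> chart_dom \<kappa>
     then vector_derivative (\<lambda>r. chart_map \<kappa> (c r)) (at t within I01) else 0)"

text \<open>
  Curves \<open>[0,1] \<rightarrow> M\<close> and vector fields along them are functions on all reals of which only the
  values on \<open>[0,1]\<close> matter; two of them represent the same object if they agree on \<open>[0,1]\<close>.
\<close>

definition Imm :: "('a::topological_space, 'e::euclidean_space) chart set \<Rightarrow> (real \<Rightarrow> 'a) set" where
  "Imm A = {c. smooth_map A I01 c \<and> (\<forall>t\<in>I01. velocity A c t \<noteq> tzero)}"

definition T_Imm ::
    "('a, 'e::euclidean_space) chart set \<Rightarrow> (real \<Rightarrow> 'a) \<Rightarrow> (real \<Rightarrow> ('a, 'e) tvec) set" where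
  "T_Imm A c = {w. smooth_field_along A I01 c w}"

definition unit_tangent ::
    "('a, 'e::euclidean_space) chart set \<Rightarrow> ('a \<Rightarrow> ('a, 'e) tvec \<Rightarrow> ('a, 'e) tvec \<Rightarrow> real)
      \<Rightarrow> (real \<Rightarrow> 'a) \<Rightarrow> real \<Rightarrow> ('a, 'e) tvec" where
  "unit_tangent A g c t = (1 / tnorm g (c t) (velocity A c t)) *\<^sub>T velocity A c t"

definition Diff_plus :: "(real \<Rightarrow> real) set" where
  "Diff_plus = {\<phi>. bij_betw \<phi> I01 I01 \<and> strict_mono_on I01 \<phi> \<and>
     smooth_on I01 \<phi> \<and> smooth_on I01 (inv_into I01 \<phi>)}"

text \<open>Paths \<open>s \<mapsto> c(s)\<close> in the space of immersions with parameter set \<open>J\<close>.\<close>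

definition imm_path ::
    "('a::topological_space, 'e::euclidean_space) chart set \<Rightarrow> real set \<Rightarrow> (real \<Rightarrow> real \<Rightarrow> 'a) \<Rightarrow> bool" where
  "imm_path A J c \<longleftrightarrow> smooth_map A (J \<times> I01) (\<lambda>(s, t). c s t) \<and> (\<forall>s\<in>J. c s \<in> Imm A)"

definition diff_path :: "(real \<Rightarrow> real \<Rightarrow> real) \<Rightarrow> bool" where
  "diff_path \<phi> \<longleftrightarrow> smooth_on (I01 \<times> I01) (\<lambda>(s, t). \<phi> s t) \<and> (\<forall>s\<in>I01. \<phi> s \<in> Diff_plus)"

definition path_s ::
    "('a, 'e::euclidean_space) chart set \<Rightarrow> (real \<Rightarrow> real \<Rightarrow> 'a) \<Rightarrow> real \<Rightarrow> real \<Rightarrow> ('a, 'e) tvec" where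
  "path_s A c s t = velocity A (\<lambda>r. c r t) s"

definition path_t ::
    "('a, 'e::euclidean_space) chart set \<Rightarrow> (real \<Rightarrow> real \<Rightarrow> 'a) \<Rightarrow> real \<Rightarrow> real \<Rightarrow> ('a, 'e) tvec" where
  "path_t A c s t = velocity A (c s) t"


section \<open>Riemannian metrics on the space of immersions\<close>

text \<open>
  The first condition makes \<open>G\<close> well defined on curves and vector fields over \<open>[0,1]\<close>. The last one
  is smoothness on the Frechet manifold of immersions in the sense of convenient calculus: smooth
  curves in the space of triples \<open>(c, w, z)\<close>, which are families that are jointly smooth on
  \<open>\<real> \<times> [0,1]\<close>, are mapped to smooth real functions. On Frechet manifolds this coincides with the
  usual notion of smoothness. \<open>G\<close> may be a weak Riemannian metric.
\<close>

definition riemannian_metric_Imm ::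
    "('a::topological_space, 'e::euclidean_space) chart set
      \<Rightarrow> ((real \<Rightarrow> 'a) \<Rightarrow> (real \<Rightarrow> ('a, 'e) tvec) \<Rightarrow> (real \<Rightarrow> ('a, 'e) tvec) \<Rightarrow> real) \<Rightarrow> bool" where
  "riemannian_metric_Imm A G \<longleftrightarrow>
     (\<forall>c\<in>Imm A. \<forall>w\<in>T_Imm A c. \<forall>z\<in>T_Imm A c. \<forall>c' w' z'.
        (\<forall>t\<in>I01. c' t = c t \<and> w' t = w t \<and> z' t = z t) \<longrightarrow> G c' w' z' = G c w z) \<and>
     (\<forall>c\<in>Imm A. \<forall>w\<in>T_Imm A c. \<forall>z\<in>T_Imm A c. G c w z = G c z w) \<and>
     (\<forall>c\<in>Imm A. \<forall>w\<in>T_Imm A c. \<forall>y\<in>T_Imm A c. \<forall>z\<in>T_Imm A c. \<forall>r.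
        G c (\<lambda>t. r *\<^sub>T w t +\<^sub>T y t) z = r * G c w z + G c y z) \<and>
     (\<forall>c\<in>Imm A. \<forall>w\<in>T_Imm A c. (\<exists>t\<in>I01. w t \<noteq> tzero) \<longrightarrow> G c w w > 0) \<and>
     (\<forall>c w z. imm_path A UNIV c \<and>
        smooth_field_along A (UNIV \<times> I01) (\<lambda>(s, t). c s t) (\<lambda>(s, t). w s t) \<and>
        smooth_field_along A (UNIV \<times> I01) (\<lambda>(s, t). c s t) (\<lambda>(s, t). z s t) \<longrightarrow>
        smooth_on UNIV (\<lambda>s. G (c s) (w s) (z s)))"

definition reparam_invariant ::
    "('a::topological_space, 'e::euclidean_space) chart set
      \<Rightarrow> ((real \<Rightarrow> 'a) \<Rightarrow> (real \<Rightarrow> ('a, 'e) tvec) \<Rightarrow> (real \<Rightarrow> ('a, 'e) tvec) \<Rightarrow> real) \<Rightarrow> bool" where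
  "reparam_invariant A G \<longleftrightarrow>
     (\<forall>c\<in>Imm A. \<forall>w\<in>T_Imm A c. \<forall>z\<in>T_Imm A c. \<forall>\<phi>\<in>Diff_plus.
        G (c \<circ> \<phi>) (w \<circ> \<phi>) (z \<circ> \<phi>) = G c w z)"

definition Ver ::
    "('a, 'e::euclidean_space) chart set \<Rightarrow> ('a \<Rightarrow> ('a, 'e) tvec \<Rightarrow> ('a, 'e) tvec \<Rightarrow> real)
      \<Rightarrow> (real \<Rightarrow> 'a) \<Rightarrow> (real \<Rightarrow> ('a, 'e) tvec) set" where
  "Ver A g c = {w. \<exists>m. smooth_on I01 m \<and> m 0 = 0 \<and> m 1 = 0 \<and>
     (\<forall>t\<in>I01. w t = m t *\<^sub>T unit_tangent A g c t)}"

definition Hor ::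
    "('a, 'e::euclidean_space) chart set \<Rightarrow> ('a \<Rightarrow> ('a, 'e) tvec \<Rightarrow> ('a, 'e) tvec \<Rightarrow> real)
      \<Rightarrow> ((real \<Rightarrow> 'a) \<Rightarrow> (real \<Rightarrow> ('a, 'e) tvec) \<Rightarrow> (real \<Rightarrow> ('a, 'e) tvec) \<Rightarrow> real)
      \<Rightarrow> (real \<Rightarrow> 'a) \<Rightarrow> (real \<Rightarrow> ('a, 'e) tvec) set" where
  "Hor A g G c = {h\<in>T_Imm A c. \<forall>m. smooth_on I01 m \<and> m 0 = 0 \<and> m 1 = 0 \<longrightarrow>
     G c h (\<lambda>t. m t *\<^sub>T unit_tangent A g c t) = 0}"

definition vertical_part ::
    "('a, 'e::euclidean_space) chart set \<Rightarrow> ('a \<Rightarrow> ('a, 'e) tvec \<Rightarrow> ('a, 'e) tvec \<Rightarrow> real)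
      \<Rightarrow> ((real \<Rightarrow> 'a) \<Rightarrow> (real \<Rightarrow> ('a, 'e) tvec) \<Rightarrow> (real \<Rightarrow> ('a, 'e) tvec) \<Rightarrow> real)
      \<Rightarrow> (real \<Rightarrow> 'a) \<Rightarrow> (real \<Rightarrow> ('a, 'e) tvec) \<Rightarrow> (real \<Rightarrow> ('a, 'e) tvec) \<Rightarrow> bool" where
  "vertical_part A g G c w u \<longleftrightarrow> u \<in> Ver A g c \<and>
     (\<exists>h\<in>Hor A g G c. \<forall>t\<in>I01. w t = u t +\<^sub>T h t)"

text \<open>\<open>T\<^sub>c\<close> is the direct sum of the vertical and the horizontal space at \<open>c\<close>.\<close>

definition Ver_Hor_split ::
    "('a, 'e::euclidean_space) chart set \<Rightarrow> ('a \<Rightarrow> ('a, 'e) tvec \<Rightarrow> ('a, 'e) tvec \<Rightarrow> real)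
      \<Rightarrow> ((real \<Rightarrow> 'a) \<Rightarrow> (real \<Rightarrow> ('a, 'e) tvec) \<Rightarrow> (real \<Rightarrow> ('a, 'e) tvec) \<Rightarrow> real)
      \<Rightarrow> (real \<Rightarrow> 'a) \<Rightarrow> bool" where
  "Ver_Hor_split A g G c \<longleftrightarrow>
     (\<forall>w\<in>T_Imm A c. \<exists>u. vertical_part A g G c w u) \<and>
     (\<forall>w\<in>Ver A g c \<inter> Hor A g G c. \<forall>t\<in>I01. w t = tzero)"


section \<open>Horizontal part of a path of curves\<close>

definition horizontal_path ::
    "('a::topological_space, 'e::euclidean_space) chart set
      \<Rightarrow> ('a \<Rightarrow> ('a, 'e) tvec \<Rightarrow> ('a, 'e) tvec \<Rightarrow> real)
      \<Rightarrow> ((real \<Rightarrow> 'a) \<Rightarrow> (real \<Rightarrow> ('a, 'e) tvec) \<Rightarrow> (real \<Rightarrow> ('a, 'e) tvec) \<Rightarrow> real)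
      \<Rightarrow> (real \<Rightarrow> real \<Rightarrow> 'a) \<Rightarrow> bool" where
  "horizontal_path A g G c \<longleftrightarrow> imm_path A I01 c \<and> (\<forall>s\<in>I01. path_s A c s \<in> Hor A g G (c s))"

definition horizontal_decomposition ::
    "('a::topological_space, 'e::euclidean_space) chart set
      \<Rightarrow> ('a \<Rightarrow> ('a, 'e) tvec \<Rightarrow> ('a, 'e) tvec \<Rightarrow> real)
      \<Rightarrow> ((real \<Rightarrow> 'a) \<Rightarrow> (real \<Rightarrow> ('a, 'e) tvec) \<Rightarrow> (real \<Rightarrow> ('a, 'e) tvec) \<Rightarrow> real)
      \<Rightarrow> (real \<Rightarrow> real \<Rightarrow> 'a) \<Rightarrow> (real \<Rightarrow> real \<Rightarrow> 'a) \<Rightarrow> (real \<Rightarrow> real \<Rightarrow> real) \<Rightarrow> bool" where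
  "horizontal_decomposition A g G c chor \<phi> \<longleftrightarrow>
     horizontal_path A g G chor \<and> diff_path \<phi> \<and> (\<forall>t\<in>I01. \<phi> 0 t = t) \<and>
     (\<forall>s\<in>I01. \<forall>t\<in>I01. c s t = chor s (\<phi> s t))"

definition horizontal_part ::
    "('a::topological_space, 'e::euclidean_space) chart set
      \<Rightarrow> ('a \<Rightarrow> ('a, 'e) tvec \<Rightarrow> ('a, 'e) tvec \<Rightarrow> real)
      \<Rightarrow> ((real \<Rightarrow> 'a) \<Rightarrow> (real \<Rightarrow> ('a, 'e) tvec) \<Rightarrow> (real \<Rightarrow> ('a, 'e) tvec) \<Rightarrow> real)
      \<Rightarrow> (real \<Rightarrow> real \<Rightarrow> 'a) \<Rightarrow> (real \<Rightarrow> real \<Rightarrow> 'a) \<Rightarrow> bool" where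
  "horizontal_part A g G c chor \<longleftrightarrow> (\<exists>\<phi>. horizontal_decomposition A g G c chor \<phi>)"

definition reparam_solution ::
    "('a, 'e::euclidean_space) chart set \<Rightarrow> ('a \<Rightarrow> ('a, 'e) tvec \<Rightarrow> ('a, 'e) tvec \<Rightarrow> real)
      \<Rightarrow> (real \<Rightarrow> real \<Rightarrow> 'a) \<Rightarrow> (real \<Rightarrow> real \<Rightarrow> real) \<Rightarrow> (real \<Rightarrow> real \<Rightarrow> real) \<Rightarrow> bool" where
  "reparam_solution A g c m \<phi> \<longleftrightarrow> diff_path \<phi> \<and> (\<forall>t\<in>I01. \<phi> 0 t = t) \<and>
     (\<forall>s\<in>I01. \<forall>t\<in>I01.
        vector_derivative (\<lambda>r. \<phi> r t) (at s within I01) =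
        m s t / tnorm g (c s t) (path_t A c s t) * vector_derivative (\<lambda>r. \<phi> s r) (at t within I01))"

end

theory Submission
  imports Defs
begin

text \<open>
  Differentiating \<open>c(s,t) = c\<^sup>h\<^sup>o\<^sup>r(s,\<phi>(s,t))\<close> gives
  \<open>c\<^sub>s = (\<phi>\<^sub>s/\<phi>\<^sub>t) c\<^sub>t + c\<^sup>h\<^sup>o\<^sup>r\<^sub>s \<circ> \<phi>\<close>. The first summand is vertical, and by reparameterization
  invariance of the metric \<open>c\<^sup>h\<^sup>o\<^sup>r\<^sub>s \<circ> \<phi>\<close> is horizontal at \<open>c\<close> if and only if \<open>c\<^sup>h\<^sup>o\<^sup>r\<^sub>s\<close> is horizontal
  at \<open>c\<^sup>h\<^sup>o\<^sup>r\<close>. As vertical components are unique, horizontality amounts to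
  \<open>m = (\<phi>\<^sub>s/\<phi>\<^sub>t) |c\<^sub>t|\<close>, which is the PDE. Two solutions \<open>\<phi>, \<phi>'\<close> of the PDE coincide because
  \<open>s \<mapsto> \<phi>'(s, \<phi>(s)\<^sup>-\<^sup>1(t))\<close> has derivative zero; here and for the smoothness of
  \<open>c(s, \<phi>(s)\<^sup>-\<^sup>1(t))\<close> the inverse function theorem is needed on the closed square.
\<close>

section \<open>Calculus of smooth maps\<close>

text \<open>No existence theorem for the PDE is proved: a solution is read off from a decomposition
  of \<open>c\<close>, which exists by the standing assumption, and conversely every solution gives
  a decomposition. The obstacle is that all calculus takes place on closed sets.
  \<open>Ck_on\<close> only says that for each order some one-sided derivative exists, so
  derivatives have to be shown unique before they can be compared, glued or called smooth. The
  inverse function theorem is needed only in part. Each \<phi>(s) is already a bijection with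
  positive derivative, so the inverse is given globally and only its regularity is at stake:
  compactness makes it continuous, an estimate makes it differentiable, and the formula for its
  derivative lifts the order step by step. The boundary enters once more in the vertical component:
  \<phi>(s) fixes 0 and 1, hence \<open>partial_s \<phi>\<close> vanishes there, and only therefore
  is the summand along \<open>c\<^sub>t\<close> an element of \<open>Ver\<close>.\<close>

lemma Ck_on_cong: "(\<And>x. x \<in> S \<Longrightarrow> f x = g x) \<Longrightarrow> Ck_on k f S \<longleftrightarrow> Ck_on k g S"
proof (cases k)
  case 0
  assume "\<And>x. x \<in> S \<Longrightarrow> f x = g x"
  then show ?thesis using 0 by (simp cong: continuous_on_cong)
next
  case (Suc n)
  assume eq: "\<And>x. x \<in> S \<Longrightarrow> f x = g x"
  have "(f has_derivative f') (at x within S) \<longleftrightarrow> (g has_derivative f') (at x within S)"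
    if "x \<in> S" for x f'
    using has_derivative_transform[OF that, of f g] has_derivative_transform[OF that, of g f] eq
    by metis
  then show ?thesis by (simp add: Suc)
qed

lemma Ck_on_SucI:
  assumes "\<And>x. x \<in> S \<Longrightarrow> (f has_derivative f' x) (at x within S)"
    and "\<And>v. Ck_on k (\<lambda>x. f' x v) S"
  shows "Ck_on (Suc k) f S"
  using assms by auto

lemma Ck_on_SucE:
  assumes "Ck_on (Suc k) f S"
  obtains f' where "\<forall>x\<in>S. (f has_derivative f' x) (at x within S)"
    and "\<forall>v. Ck_on k (\<lambda>x. f' x v) S"
  using assms by auto

declare Ck_on.simps(2) [simp del]

lemma Ck_on_subset: "Ck_on k f S \<Longrightarrow> T \<subseteq> S \<Longrightarrow> Ck_on k f T"
proof (induction k arbitrary: f)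
  case 0
  then show ?case by (auto intro: continuous_on_subset)
next
  case (Suc k)
  from Suc.prems(1) obtain f' where "\<forall>x\<in>S. (f has_derivative f' x) (at x within S)"
    "\<forall>v. Ck_on k (\<lambda>x. f' x v) S"
    by (rule Ck_on_SucE)
  note f = this[rule_format]
  show ?case
    by (rule Ck_on_SucI[OF has_derivative_subset[OF f(1)] Suc.IH[OF f(2)]])
      (use Suc.prems in auto)
qed

lemma Ck_on_mono: "Ck_on (Suc k) f S \<Longrightarrow> Ck_on k f S"
proof (induction k arbitrary: f)
  case 0
  then obtain f' where "\<forall>x\<in>S. (f has_derivative f' x) (at x within S)"
    by (rule Ck_on_SucE)
  then show ?case
    by (simp add: continuous_on_eq_continuous_within) (blast intro: has_derivative_continuous)
next
  case (Suc k)
  from Suc.prems obtain f' where "\<forall>x\<in>S. (f has_derivative f' x) (at x within S)"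
    "\<forall>v. Ck_on (Suc k) (\<lambda>x. f' x v) S"
    by (rule Ck_on_SucE)
  note f = this[rule_format]
  show ?case
    by (rule Ck_on_SucI[OF f(1) Suc.IH[OF f(2)]])
qed

lemma Ck_on_const: "Ck_on k (\<lambda>x. a) S"
proof (induction k arbitrary: a)
  case (Suc k)
  show ?case
    by (rule Ck_on_SucI[OF has_derivative_const Suc.IH])
qed simp

lemma Ck_on_bounded_linear: "bounded_linear f \<Longrightarrow> Ck_on k f S"
  by (cases k) (auto intro!: linear_continuous_on Ck_on_SucI[of _ _ "\<lambda>x. f"]
      bounded_linear_imp_has_derivative Ck_on_const)

lemma Ck_on_add: "Ck_on k f S \<Longrightarrow> Ck_on k g S \<Longrightarrow> Ck_on k (\<lambda>x. f x + g x) S"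
proof (induction k arbitrary: f g)
  case 0
  then show ?case by (auto intro: continuous_on_add)
next
  case (Suc k)
  from Suc.prems(1) obtain f' where "\<forall>x\<in>S. (f has_derivative f' x) (at x within S)"
    "\<forall>v. Ck_on k (\<lambda>x. f' x v) S"
    by (rule Ck_on_SucE)
  note f = this[rule_format]
  from Suc.prems(2) obtain g' where "\<forall>x\<in>S. (g has_derivative g' x) (at x within S)"
    "\<forall>v. Ck_on k (\<lambda>x. g' x v) S"
    by (rule Ck_on_SucE)
  note g = this[rule_format]
  show ?case
    by (rule Ck_on_SucI[of _ _ "\<lambda>x v. f' x v + g' x v"])
      (use f g Suc.IH in \<open>auto intro!: has_derivative_add\<close>)
qed

lemma Ck_on_sum: "(\<And>i. i \<in> I \<Longrightarrow> Ck_on k (f i) S) \<Longrightarrow> Ck_on k (\<lambda>x. \<Sum>i\<in>I. f i x) S"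
  by (induction I rule: infinite_finite_induct) (auto intro: Ck_on_const Ck_on_add)

text \<open>Leibniz' rule, done once for every bilinear product. The derivative again contains
  \<open>f\<close> and \<open>g\<close> themselves, which is why the induction has to lower their
  order with \<open>Ck_on_mono\<close>.\<close>

lemma Ck_on_bounded_bilinear:
  assumes "bounded_bilinear pr"
  shows "Ck_on k f S \<Longrightarrow> Ck_on k g S \<Longrightarrow> Ck_on k (\<lambda>x. pr (f x) (g x)) S"
proof (induction k arbitrary: f g)
  case 0
  then show ?case by (auto intro: bounded_bilinear.continuous_on[OF assms])
next
  case (Suc k)
  from Suc.prems(1) obtain f' where "\<forall>x\<in>S. (f has_derivative f' x) (at x within S)"
    "\<forall>v. Ck_on k (\<lambda>x. f' x v) S"
    by (rule Ck_on_SucE)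
  note f = this[rule_format]
  from Suc.prems(2) obtain g' where "\<forall>x\<in>S. (g has_derivative g' x) (at x within S)"
    "\<forall>v. Ck_on k (\<lambda>x. g' x v) S"
    by (rule Ck_on_SucE)
  note g = this[rule_format]
  show ?case
  proof (rule Ck_on_SucI)
    show "((\<lambda>x. pr (f x) (g x)) has_derivative (\<lambda>v. pr (f x) (g' x v) + pr (f' x v) (g x)))
      (at x within S)" if "x \<in> S" for x
      using that by (intro bounded_bilinear.FDERIV[OF assms] f g)
    show "Ck_on k (\<lambda>x. pr (f x) (g' x v) + pr (f' x v) (g x)) S" for v
      using Suc.prems by (intro Ck_on_add Suc.IH f g) (auto intro: Ck_on_mono)
  qed
qed

lemmas Ck_on_mult = Ck_on_bounded_bilinear[OF bounded_bilinear_mult]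
  and Ck_on_scaleR = Ck_on_bounded_bilinear[OF bounded_bilinear_scaleR]
  and Ck_on_inner = Ck_on_bounded_bilinear[OF bounded_bilinear_inner]

lemma Ck_on_Pair: "Ck_on k f S \<Longrightarrow> Ck_on k g S \<Longrightarrow> Ck_on k (\<lambda>x. (f x, g x)) S"
proof (induction k arbitrary: f g)
  case 0
  then show ?case by (auto intro: continuous_on_Pair)
next
  case (Suc k)
  from Suc.prems(1) obtain f' where "\<forall>x\<in>S. (f has_derivative f' x) (at x within S)"
    "\<forall>v. Ck_on k (\<lambda>x. f' x v) S"
    by (rule Ck_on_SucE)
  note f = this[rule_format]
  from Suc.prems(2) obtain g' where "\<forall>x\<in>S. (g has_derivative g' x) (at x within S)"
    "\<forall>v. Ck_on k (\<lambda>x. g' x v) S"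
    by (rule Ck_on_SucE)
  note g = this[rule_format]
  show ?case
    by (rule Ck_on_SucI[of _ _ "\<lambda>x v. (f' x v, g' x v)"])
      (use f g Suc.IH in \<open>auto intro!: has_derivative_Pair\<close>)
qed

lemma linear_euclidean_expansion:
  fixes L :: "'b::euclidean_space \<Rightarrow> 'c::real_vector"
  assumes "linear L"
  shows "L v = (\<Sum>b\<in>Basis. (v \<bullet> b) *\<^sub>R L b)"
proof -
  have "L v = L (\<Sum>b\<in>Basis. (v \<bullet> b) *\<^sub>R b)" by (simp add: euclidean_representation)
  also have "\<dots> = (\<Sum>b\<in>Basis. (v \<bullet> b) *\<^sub>R L b)"
    by (simp only: linear_sum[OF assms] linear_cmul[OF assms])
  finally show ?thesis .
qed

text \<open>Only directional derivatives of \<open>g\<close> are known to be \<open>C\<^sup>k\<close>; expanding \<open>f' x v\<close> in a basis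
  writes the derivative of the composition as a finite sum of products of such derivatives.\<close>

lemma Ck_on_compose:
  fixes f :: "'a::real_normed_vector \<Rightarrow> 'b::euclidean_space"
    and g :: "'b \<Rightarrow> 'c::real_normed_vector"
  shows "Ck_on k g T \<Longrightarrow> Ck_on k f S \<Longrightarrow> f ` S \<subseteq> T \<Longrightarrow> Ck_on k (\<lambda>x. g (f x)) S"
proof (induction k arbitrary: f g)
  case 0
  then show ?case by (auto intro: continuous_on_compose2)
next
  case (Suc k)
  from Suc.prems(2) obtain f' where "\<forall>x\<in>S. (f has_derivative f' x) (at x within S)"
    "\<forall>v. Ck_on k (\<lambda>x. f' x v) S"
    by (rule Ck_on_SucE)
  note f = this[rule_format]
  from Suc.prems(1) obtain g' where "\<forall>x\<in>T. (g has_derivative g' x) (at x within T)"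
    "\<forall>v. Ck_on k (\<lambda>x. g' x v) T"
    by (rule Ck_on_SucE)
  note g = this[rule_format]
  show ?case
  proof (rule Ck_on_SucI)
    show "((\<lambda>x. g (f x)) has_derivative (\<lambda>v. g' (f x) (f' x v))) (at x within S)" if "x \<in> S" for x
      by (rule has_derivative_in_compose2[OF g(1) Suc.prems(3) that f(1)[OF that]])
    fix v
    have "Ck_on k (\<lambda>x. g' (f x) b) S" for b
      by (rule Suc.IH[OF g(2) Ck_on_mono[OF Suc.prems(2)] Suc.prems(3)])
    then have "Ck_on k (\<lambda>x. \<Sum>b\<in>Basis. (f' x v \<bullet> b) *\<^sub>R g' (f x) b) S"
      by (intro Ck_on_sum Ck_on_scaleR Ck_on_inner Ck_on_const f(2))
    moreover have "g' (f x) (f' x v) = (\<Sum>b\<in>Basis. (f' x v \<bullet> b) *\<^sub>R g' (f x) b)" if "x \<in> S" for x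
      using Suc.prems(3) that
      by (intro linear_euclidean_expansion has_derivative_linear[OF g(1)]) auto
    ultimately show "Ck_on k (\<lambda>x. g' (f x) (f' x v)) S"
      by (simp cong: Ck_on_cong)
  qed
qed

text \<open>The derivative of the reciprocal is a polynomial in the reciprocal, so order
  \<open>k\<close> of the function is order \<open>k\<close> of its derivative.\<close>

lemma Ck_on_inverse: "Ck_on k (inverse :: real \<Rightarrow> real) (- {0})"
proof (induction k)
  case 0
  show ?case by (auto intro!: continuous_intros)
next
  case (Suc k)
  then have "Ck_on k (\<lambda>x::real. (- 1) * (inverse x * v * inverse x)) (- {0})" for v
    by (intro Ck_on_mult Ck_on_const)
  then show ?case
    by (intro Ck_on_SucI[of _ _ "\<lambda>x h. - (inverse x * h * inverse x)"] has_derivative_inverse') auto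
qed

text \<open>Again the derivative is expressed by the function itself, here as half the reciprocal of
  the root; the domain is open at 0 because the derivative is unbounded there.\<close>

lemma Ck_on_sqrt: "Ck_on k sqrt {0<..}"
proof (induction k)
  case 0
  show ?case by (auto intro!: continuous_intros)
next
  case (Suc k)
  have "Ck_on k (\<lambda>x. inverse (sqrt x)) {0<..}"
    using Suc by (intro Ck_on_compose[OF Ck_on_inverse]) auto
  then have "Ck_on k (\<lambda>x. inverse (sqrt x) * (1 / 2) * v) {0<..}" for v
    by (intro Ck_on_mult Ck_on_const)
  moreover have "(sqrt has_derivative (\<lambda>v. inverse (sqrt x) * (1 / 2) * v)) (at x within {0<..})"
    if "x \<in> {0<..}" for x
  proof -
    have "(*) (inverse (sqrt x) / 2) = (\<lambda>v. inverse (sqrt x) * (1 / 2) * v)"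
      by auto
    then show ?thesis
      using DERIV_real_sqrt[of x] that has_derivative_at_withinI
      unfolding has_field_derivative_def by fastforce
  qed
  ultimately show ?case
    by (intro Ck_on_SucI)
qed

text \<open>Derivatives chosen on different neighbourhoods can only be glued if they are unique.
  Without isolated points they are, and on subsets of the line \<open>vector_derivative\<close>
  names the common value. This turns smoothness chart by chart into smoothness along a whole
  curve.\<close>

lemma Ck_on_local:
  fixes S :: "real set"
  assumes "\<And>x. x \<in> S \<Longrightarrow> at x within S \<noteq> bot"
  shows "(\<And>x. x \<in> S \<Longrightarrow> \<exists>U. open U \<and> x \<in> U \<and> Ck_on k f (S \<inter> U)) \<Longrightarrow> Ck_on k f S"
proof (induction k arbitrary: f)
  case 0
  have "continuous (at x within S) f" if "x \<in> S" for x
  proof -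
    obtain U where U: "open U" "x \<in> U" "continuous_on (S \<inter> U) f" using 0 \<open>x \<in> S\<close> by force
    then have "continuous (at x within (S \<inter> U)) f"
      using that by (auto simp: continuous_on_eq_continuous_within)
    moreover have "at x within (S \<inter> U) = at x within S"
      using U by (intro at_within_nhd[of _ U]) auto
    ultimately show ?thesis by simp
  qed
  then show ?case by (simp add: continuous_on_eq_continuous_within)
next
  case (Suc k)
  let ?d = "\<lambda>x. vector_derivative f (at x within S)"
  \<comment> \<open>A relatively open piece of \<open>S\<close> has the same filter at its points as
    \<open>S\<close>, so every derivative chosen there is multiplication by the globally defined
    \<open>?d\<close>.\<close>
  have *: "\<exists>f'. (\<forall>z\<in>S \<inter> U. (f has_derivative f' z) (at z within S) \<and> f' z = (\<lambda>h. h *\<^sub>R ?d z)) \<and>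
      (\<forall>v. Ck_on k (\<lambda>z. f' z v) (S \<inter> U))" if "open U" "Ck_on (Suc k) f (S \<inter> U)" for U
  proof -
    from that(2) obtain f' where "\<forall>x\<in>S \<inter> U. (f has_derivative f' x) (at x within (S \<inter> U))"
      "\<forall>v. Ck_on k (\<lambda>x. f' x v) (S \<inter> U)"
      by (rule Ck_on_SucE)
    note f' = this[rule_format]
    have d: "(f has_derivative f' z) (at z within S)" if "z \<in> S \<inter> U" for z
    proof -
      have "at z within (S \<inter> U) = at z within S"
        using that \<open>open U\<close> by (intro at_within_nhd[of _ U]) auto
      then show ?thesis using f'(1)[OF that] by simp
    qed
    have "f' z = (\<lambda>h. h *\<^sub>R ?d z)" if "z \<in> S \<inter> U" for z
    proof -
      interpret L: bounded_linear "f' z" by (rule has_derivative_bounded_linear[OF d[OF that]])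
      have "f' z h = h *\<^sub>R f' z 1" for h
        using L.scaleR[of h 1] by simp
      then have eq: "f' z = (\<lambda>h. h *\<^sub>R f' z 1)"
        by (rule ext)
      have "(f has_vector_derivative f' z 1) (at z within S)"
        unfolding has_vector_derivative_def by (rule has_derivative_eq_rhs[OF d[OF that] eq])
      then have "?d z = f' z 1"
        using that assms by (intro vector_derivative_within) auto
      then show ?thesis using eq by metis
    qed
    with d f'(2) show ?thesis by blast
  qed
  show ?case
  proof (rule Ck_on_SucI)
    show "(f has_derivative (\<lambda>h. h *\<^sub>R ?d x)) (at x within S)" if "x \<in> S" for x
    proof -
      obtain U where U: "open U" "x \<in> U" "Ck_on (Suc k) f (S \<inter> U)"
        using Suc.prems \<open>x \<in> S\<close> by blast
      from *[OF U(1,3)] obtain f' where "\<forall>z\<in>S \<inter> U. (f has_derivative f' z) (at z within S) \<and>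
          f' z = (\<lambda>h. h *\<^sub>R ?d z)"
        by blast
      then show ?thesis using U(2) \<open>x \<in> S\<close> by (metis IntI)
    qed
    fix v
    show "Ck_on k (\<lambda>x. v *\<^sub>R ?d x) S"
    proof (rule Suc.IH)
      fix x assume "x \<in> S"
      then obtain U where U: "open U" "x \<in> U" "Ck_on (Suc k) f (S \<inter> U)"
        using Suc.prems by blast
      from *[OF U(1,3)] obtain f' where f': "\<forall>z\<in>S \<inter> U. f' z = (\<lambda>h. h *\<^sub>R ?d z)"
        "\<forall>v. Ck_on k (\<lambda>z. f' z v) (S \<inter> U)"
        by blast
      have "Ck_on k (\<lambda>z. v *\<^sub>R ?d z) (S \<inter> U) \<longleftrightarrow> Ck_on k (\<lambda>z. f' z v) (S \<inter> U)"
        using f'(1) by (intro Ck_on_cong) simp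
      with f'(2) U show "\<exists>U. open U \<and> x \<in> U \<and> Ck_on k (\<lambda>x. v *\<^sub>R ?d x) (S \<inter> U)"
        by blast
    qed
  qed
qed

section \<open>Closure properties of infinitely differentiable functions\<close>

lemma smooth_on_cong: "(\<And>x. x \<in> S \<Longrightarrow> f x = g x) \<Longrightarrow> smooth_on S f \<longleftrightarrow> smooth_on S g"
  unfolding smooth_on_def by (simp cong: Ck_on_cong)

lemma smooth_on_subset: "smooth_on S f \<Longrightarrow> T \<subseteq> S \<Longrightarrow> smooth_on T f"
  unfolding smooth_on_def by (blast intro: Ck_on_subset)

lemma smooth_on_const: "smooth_on S (\<lambda>x. a)"
  unfolding smooth_on_def by (simp add: Ck_on_const)

lemma smooth_on_bounded_linear: "bounded_linear f \<Longrightarrow> smooth_on S f"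
  unfolding smooth_on_def by (simp add: Ck_on_bounded_linear)

lemma smooth_on_add: "smooth_on S f \<Longrightarrow> smooth_on S g \<Longrightarrow> smooth_on S (\<lambda>x. f x + g x)"
  unfolding smooth_on_def by (simp add: Ck_on_add)

lemma smooth_on_sum: "(\<And>i. i \<in> I \<Longrightarrow> smooth_on S (f i)) \<Longrightarrow> smooth_on S (\<lambda>x. \<Sum>i\<in>I. f i x)"
  unfolding smooth_on_def by (simp add: Ck_on_sum)

lemma smooth_on_scaleR: "smooth_on S f \<Longrightarrow> smooth_on S g \<Longrightarrow> smooth_on S (\<lambda>x. f x *\<^sub>R g x)"
  unfolding smooth_on_def by (simp add: Ck_on_scaleR)

lemma smooth_on_mult:
  fixes f g :: "'a::real_normed_vector \<Rightarrow> real"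
  shows "smooth_on S f \<Longrightarrow> smooth_on S g \<Longrightarrow> smooth_on S (\<lambda>x. f x * g x)"
  unfolding smooth_on_def by (simp add: Ck_on_mult)

lemma smooth_on_inner: "smooth_on S f \<Longrightarrow> smooth_on S g \<Longrightarrow> smooth_on S (\<lambda>x. f x \<bullet> g x)"
  unfolding smooth_on_def by (simp add: Ck_on_inner)

lemma smooth_on_Pair: "smooth_on S f \<Longrightarrow> smooth_on S g \<Longrightarrow> smooth_on S (\<lambda>x. (f x, g x))"
  unfolding smooth_on_def by (simp add: Ck_on_Pair)

lemma smooth_on_compose:
  fixes f :: "'a::real_normed_vector \<Rightarrow> 'b::euclidean_space"
  shows "smooth_on T g \<Longrightarrow> smooth_on S f \<Longrightarrow> f ` S \<subseteq> T \<Longrightarrow> smooth_on S (\<lambda>x. g (f x))"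
  unfolding smooth_on_def by (blast intro: Ck_on_compose)

lemma smooth_on_divide:
  fixes f g :: "'a::real_normed_vector \<Rightarrow> real"
  assumes "smooth_on S f" "smooth_on S g" "\<And>x. x \<in> S \<Longrightarrow> g x \<noteq> 0"
  shows "smooth_on S (\<lambda>x. f x / g x)"
proof -
  have "smooth_on S (\<lambda>x. inverse (g x))"
    using assms by (intro smooth_on_compose[of "- {0}" inverse S g])
      (auto simp: smooth_on_def Ck_on_inverse)
  then show ?thesis
    unfolding divide_inverse by (intro smooth_on_mult assms)
qed

lemma smooth_on_sqrt:
  assumes "smooth_on S f" "\<And>x. x \<in> S \<Longrightarrow> f x > 0"
  shows "smooth_on S (\<lambda>x. sqrt (f x))"
  using assms by (intro smooth_on_compose[of "{0<..}" sqrt S f]) (auto simp: smooth_on_def Ck_on_sqrt)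

lemma smooth_on_continuous: "smooth_on S f \<Longrightarrow> continuous_on S f"
  unfolding smooth_on_def by (metis Ck_on.simps(1))

lemma smooth_on_has_derivative:
  assumes "smooth_on S f" "x \<in> S"
  obtains f' where "(f has_derivative f') (at x within S)"
proof -
  have "Ck_on (Suc 0) f S" using assms(1) unfolding smooth_on_def by blast
  then obtain f' where "\<forall>x\<in>S. (f has_derivative f' x) (at x within S)"
    by (rule Ck_on_SucE)
  then show ?thesis using that assms(2) by blast
qed

lemma smooth_on_local:
  fixes S :: "real set"
  assumes "\<And>x. x \<in> S \<Longrightarrow> at x within S \<noteq> bot"
    and "\<And>x. x \<in> S \<Longrightarrow> \<exists>U. open U \<and> x \<in> U \<and> smooth_on (S \<inter> U) f"
  shows "smooth_on S f"
  unfolding smooth_on_def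
proof (intro allI Ck_on_local)
  show "\<exists>U. open U \<and> x \<in> U \<and> Ck_on k f (S \<inter> U)" if "x \<in> S" for x k
    using assms(2)[OF that] unfolding smooth_on_def by blast
qed (rule assms(1))

text \<open>Each order in \<open>smooth_on\<close> may come with a different derivative
  \<open>f'\<close>. Identifying all of them in the direction \<open>v\<close> with one function
  \<open>D\<close> is what makes \<open>D\<close> smooth to every order.\<close>

lemma smooth_on_directional_derivative:
  assumes "smooth_on S f"
    and "\<And>x f'. x \<in> S \<Longrightarrow> (f has_derivative f') (at x within S) \<Longrightarrow> f' v = D x"
  shows "smooth_on S D"
  unfolding smooth_on_def
proof
  fix k
  have "Ck_on (Suc k) f S" using assms(1) unfolding smooth_on_def by blast
  then obtain f' where f': "\<forall>x\<in>S. (f has_derivative f' x) (at x within S)"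
    "\<forall>v. Ck_on k (\<lambda>x. f' x v) S"
    by (rule Ck_on_SucE)
  have "Ck_on k (\<lambda>x. f' x v) S \<longleftrightarrow> Ck_on k D S"
    using f'(1) assms(2) by (intro Ck_on_cong) blast
  with f'(2) show "Ck_on k D S" by blast
qed

section \<open>One-sided derivatives on the unit interval and the unit square\<close>

lemma at_within_I01: "t \<in> I01 \<Longrightarrow> at t within I01 \<noteq> bot"
proof -
  assume "t \<in> I01"
  moreover have "\<not> (\<exists>x. I01 = {x})"
    by (metis atLeastAtMost_singleton_iff zero_neq_one)
  ultimately show ?thesis
    using connected_imp_perfect[of I01 t] by (simp add: trivial_limit_within)
qed

lemma vector_derivative_I01:
  "t \<in> I01 \<Longrightarrow> (f has_vector_derivative d) (at t within I01) \<Longrightarrow> vector_derivative f (at t within I01) = d"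
  by (intro vector_derivative_within at_within_I01)

text \<open>The preimage of an open set is relatively open, so restricting to it leaves the filter
  unchanged. Chart expressions are smooth only on such preimages, and this returns their derivatives
  to the full parameter set.\<close>

lemma at_within_preimage:
  assumes "continuous_on T f" "open U" "x \<in> T" "f x \<in> U"
  shows "at x within (T \<inter> f -` U) = at x within T"
proof -
  obtain V where "open V" "V \<inter> T = f -` U \<inter> T"
    using assms(1,2) by (auto simp: continuous_on_open_invariant)
  then show ?thesis
    using assms by (intro at_within_nhd[of _ V]) auto
qed

lemma has_derivative_vector_derivative:
  fixes f :: "real \<Rightarrow> 'b::real_normed_vector"
  assumes "(f has_derivative f') F"
  shows "(f has_vector_derivative f' 1) F"
proof -
  interpret bounded_linear f' by (rule has_derivative_bounded_linear[OF assms])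
  have "f' h = h *\<^sub>R f' 1" for h
    using scaleR[of h 1] by simp
  then show ?thesis
    unfolding has_vector_derivative_def by (intro has_derivative_eq_rhs[OF assms] ext)
qed

lemma smooth_on_vector_derivative:
  fixes f :: "real \<Rightarrow> 'b::real_normed_vector"
  assumes "smooth_on S f" "\<And>t. t \<in> S \<Longrightarrow> at t within S = at t within I01" "S \<subseteq> I01"
  shows "smooth_on S (\<lambda>t. vector_derivative f (at t within I01))"
proof (rule smooth_on_directional_derivative[OF assms(1)])
  fix t f' assume t: "t \<in> S" and "(f has_derivative f') (at t within S)"
  then have "(f has_vector_derivative f' 1) (at t within I01)"
    unfolding assms(2)[OF t] by (intro has_derivative_vector_derivative)
  then show "f' 1 = vector_derivative f (at t within I01)"
    by (rule vector_derivative_I01[OF subsetD[OF assms(3) t], symmetric])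
qed

text \<open>The segments through \<open>(s, t)\<close> parallel to the axes stay inside the square,
  so the derivative within the square can be composed with them even at edges and corners.\<close>

lemma partial_derivatives:
  fixes F :: "real \<times> real \<Rightarrow> 'b::real_normed_vector"
  assumes F: "(F has_derivative F') (at (s, t) within I01 \<times> I01)" and "s \<in> I01" "t \<in> I01"
  shows "((\<lambda>r. F (r, t)) has_vector_derivative F' (1, 0)) (at s within I01)"
    and "((\<lambda>r. F (s, r)) has_vector_derivative F' (0, 1)) (at t within I01)"
    and "F' v = fst v *\<^sub>R F' (1, 0) + snd v *\<^sub>R F' (0, 1)"
proof -
  interpret bounded_linear F' by (rule has_derivative_bounded_linear[OF F])
  have "((\<lambda>r. F (r, t)) has_derivative (\<lambda>h. F' (h, 0))) (at s within I01)"
    by (rule has_derivative_in_compose[where f="\<lambda>r. (r, t)" and g=F and g'=F'])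
      (use assms in \<open>auto intro!: derivative_eq_intros has_derivative_subset[OF F]\<close>)
  from has_derivative_vector_derivative[OF this]
  show "((\<lambda>r. F (r, t)) has_vector_derivative F' (1, 0)) (at s within I01)" .
  have "((\<lambda>r. F (s, r)) has_derivative (\<lambda>h. F' (0, h))) (at t within I01)"
    by (rule has_derivative_in_compose[where f="\<lambda>r. (s, r)" and g=F and g'=F'])
      (use assms in \<open>auto intro!: derivative_eq_intros has_derivative_subset[OF F]\<close>)
  from has_derivative_vector_derivative[OF this]
  show "((\<lambda>r. F (s, r)) has_vector_derivative F' (0, 1)) (at t within I01)" .
  have "F' v = F' (fst v *\<^sub>R (1, 0) + snd v *\<^sub>R (0, 1))" by simp
  also have "\<dots> = fst v *\<^sub>R F' (1, 0) + snd v *\<^sub>R F' (0, 1)" by (simp only: add scaleR)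
  finally show "F' v = fst v *\<^sub>R F' (1, 0) + snd v *\<^sub>R F' (0, 1)" .
qed

abbreviation partial_s :: "(real \<Rightarrow> real \<Rightarrow> 'b::real_normed_vector) \<Rightarrow> real \<Rightarrow> real \<Rightarrow> 'b" where
  "partial_s f s t \<equiv> vector_derivative (\<lambda>r. f r t) (at s within I01)"

abbreviation partial_t :: "(real \<Rightarrow> real \<Rightarrow> 'b::real_normed_vector) \<Rightarrow> real \<Rightarrow> real \<Rightarrow> 'b" where
  "partial_t f s t \<equiv> vector_derivative (\<lambda>r. f s r) (at t within I01)"

text \<open>The one-sided partial derivatives force the values of any derivative on the two
  coordinate vectors. All choices of a derivative thus agree, and the partial derivatives inherit
  smoothness.\<close>

lemma smooth_square:
  fixes f :: "real \<Rightarrow> real \<Rightarrow> 'b::real_normed_vector"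
  assumes f: "smooth_on (I01 \<times> I01) (\<lambda>(s, t). f s t)"
  shows has_derivative_square: "s \<in> I01 \<Longrightarrow> t \<in> I01 \<Longrightarrow>
      ((\<lambda>(s, t). f s t) has_derivative (\<lambda>v. fst v *\<^sub>R partial_s f s t + snd v *\<^sub>R partial_t f s t))
        (at (s, t) within I01 \<times> I01)"
    and smooth_on_partial_s: "smooth_on (I01 \<times> I01) (\<lambda>(s, t). partial_s f s t)"
    and smooth_on_partial_t: "smooth_on (I01 \<times> I01) (\<lambda>(s, t). partial_t f s t)"
proof -
  have eq: "partial_s f s t = F' (1, 0)" "partial_t f s t = F' (0, 1)"
    if "((\<lambda>(s, t). f s t) has_derivative F') (at (s, t) within I01 \<times> I01)" "s \<in> I01" "t \<in> I01"
    for F' s t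
    using partial_derivatives(1,2)[OF that] that(2,3) by (simp_all add: vector_derivative_I01)
  show "((\<lambda>(s, t). f s t) has_derivative (\<lambda>v. fst v *\<^sub>R partial_s f s t + snd v *\<^sub>R partial_t f s t))
        (at (s, t) within I01 \<times> I01)" if st: "s \<in> I01" "t \<in> I01"
  proof -
    obtain F' where F': "((\<lambda>(s, t). f s t) has_derivative F') (at (s, t) within I01 \<times> I01)"
      using smooth_on_has_derivative[OF f, of "(s, t)"] st by blast
    have "F' = (\<lambda>v. fst v *\<^sub>R partial_s f s t + snd v *\<^sub>R partial_t f s t)"
      unfolding eq[OF F' st] by (rule ext) (rule partial_derivatives(3)[OF F' st])
    then show ?thesis using F' by (rule has_derivative_eq_rhs[rotated])
  qed
  show "smooth_on (I01 \<times> I01) (\<lambda>(s, t). partial_s f s t)"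
    by (rule smooth_on_directional_derivative[OF f, of "(1, 0)"]) (auto dest: eq)
  show "smooth_on (I01 \<times> I01) (\<lambda>(s, t). partial_t f s t)"
    by (rule smooth_on_directional_derivative[OF f, of "(0, 1)"]) (auto dest: eq)
qed

text \<open>Continuity of \<open>g\<close> carries the remainder estimate for \<open>f\<close> at
  \<open>g y\<close> over to points near \<open>y\<close>, and the left inverse \<open>g'\<close> of
  \<open>f'\<close> turns it into an estimate for \<open>g\<close>. As \<open>g\<close> is given on
  all of \<open>T\<close>, the sets may be closed and \<open>y\<close> may lie on the
  boundary.\<close>

lemma has_derivative_inverse_within:
  fixes f :: "'a::real_normed_vector \<Rightarrow> 'b::real_normed_vector"
  assumes f: "(f has_derivative f') (at (g y) within S)"
    and g': "bounded_linear g'" "\<And>v. g' (f' v) = v"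
    and g: "continuous (at y within T) g" "g ` T \<subseteq> S" "y \<in> T"
    and fg: "\<And>z. z \<in> T \<Longrightarrow> f (g z) = z"
  shows "(g has_derivative g') (at y within T)"
  unfolding has_derivative_within_alt2
proof (intro conjI allI impI)
  interpret G: bounded_linear g' by (rule g')
  interpret F: bounded_linear f' by (rule has_derivative_bounded_linear[OF f])
  show "bounded_linear g'" by (rule g')
  obtain B where B: "B > 0" "\<And>v. norm (g' v) \<le> norm v * B"
    using G.pos_bounded by blast
  fix e :: real assume "e > 0"
  \<comment> \<open>The first bound gives \<open>B * d \<le> 1 / 2\<close>, so that the error can be
    absorbed below; the second gives \<open>2 * B * B * d \<le> e\<close>, the factor in the final
    estimate.\<close>
  define d where "d = min (1 / (2 * B)) (e / (2 * B * B))"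
  have d: "d > 0" "B * d \<le> 1 / 2" "2 * B * B * d \<le> e"
    using B(1) \<open>e > 0\<close> by (auto simp: d_def min_def field_simps)
  \<comment> \<open>The filter at \<open>g y\<close> omits that point, so
    \<open>g z \<noteq> g y\<close> is needed for \<open>z \<noteq> y\<close>; this follows from
    \<open>f (g z) = z\<close>.\<close>
  have "filterlim g (at (g y) within S) (at y within T)"
    unfolding filterlim_at
  proof (intro conjI)
    have "g z \<in> S \<and> g z \<noteq> g y" if "z \<in> T" "z \<noteq> y" for z
      using fg[of z] fg[of y] that g by auto
    then show "\<forall>\<^sub>F z in at y within T. g z \<in> S \<and> g z \<noteq> g y"
      by (auto simp: eventually_at_filter)
    show "(g \<longlongrightarrow> g y) (at y within T)"
      using g(1) by (simp add: continuous_within)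
  qed
  moreover have "\<forall>\<^sub>F x in at (g y) within S. norm (f x - f (g y) - f' (x - g y)) \<le> d * norm (x - g y)"
    using f d(1) unfolding has_derivative_within_alt2 by blast
  ultimately have "\<forall>\<^sub>F z in at y within T.
      norm (f (g z) - f (g y) - f' (g z - g y)) \<le> d * norm (g z - g y)"
    by (rule filterlim_iff[THEN iffD1, rule_format])
  moreover have "\<forall>\<^sub>F z in at y within T. z \<in> T"
    by (simp add: eventually_at_filter)
  ultimately show "\<forall>\<^sub>F z in at y within T. norm (g z - g y - g' (z - y)) \<le> e * norm (z - y)"
  proof eventually_elim
    case (elim z)
    define R where "R = f (g z) - f (g y) - f' (g z - g y)"
    have R: "norm R \<le> d * norm (g z - g y)" using elim R_def by simp
    have zy: "z - y = f' (g z - g y) + R" using elim fg[of z] fg[of y] g(3) by (simp add: R_def)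
    have eq: "g' (z - y) = (g z - g y) + g' R" unfolding zy G.add g'(2) ..
    have "norm (g' R) \<le> norm R * B" by (rule B(2))
    also have "\<dots> \<le> d * norm (g z - g y) * B"
      using R B(1) by (intro mult_right_mono) auto
    finally have gR: "norm (g' R) \<le> B * d * norm (g z - g y)" by (simp add: mult_ac)
    \<comment> \<open>The error \<open>g' R\<close> is at most half of
      \<open>norm (g z - g y)\<close>; moving it to the left side shows that \<open>g\<close> is
      Lipschitz at \<open>y\<close> with constant \<open>2 * B\<close>.\<close>
    have "norm (g z - g y) \<le> norm (g' (z - y)) + norm (g' R)"
      unfolding eq using norm_triangle_sub[of "g z - g y" "g z - g y + g' R"] by simp
    also have "\<dots> \<le> B * norm (z - y) + norm (g z - g y) / 2"
      using B(2)[of "z - y"] gR mult_right_mono[OF d(2), of "norm (g z - g y)"]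
      by (simp add: mult_ac)
    finally have bound: "norm (g z - g y) \<le> 2 * B * norm (z - y)" by simp
    have "norm (g z - g y - g' (z - y)) = norm (g' R)" unfolding eq by simp
    also have "\<dots> \<le> B * d * (2 * B * norm (z - y))"
      by (rule order_trans[OF gR mult_left_mono[OF bound]]) (use B(1) d(1) in simp)
    also have "\<dots> = 2 * B * B * d * norm (z - y)" by simp
    also have "\<dots> \<le> e * norm (z - y)"
      using d(3) by (intro mult_right_mono) auto
    finally show ?case .
  qed
qed

section \<open>Paths of diffeomorphisms of the interval\<close>

lemma Diff_plus_bij: "\<phi> \<in> Diff_plus \<Longrightarrow> bij_betw \<phi> I01 I01"
  unfolding Diff_plus_def by blast

lemma Diff_plus_in: "\<phi> \<in> Diff_plus \<Longrightarrow> t \<in> I01 \<Longrightarrow> \<phi> t \<in> I01"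
  using Diff_plus_bij bij_betwE by blast

lemma Diff_plus_inv:
  assumes "\<phi> \<in> Diff_plus" "t \<in> I01"
  shows "inv_into I01 \<phi> t \<in> I01" "\<phi> (inv_into I01 \<phi> t) = t" "inv_into I01 \<phi> (\<phi> t) = t"
  using Diff_plus_bij[OF assms(1)] assms(2)
  by (auto simp: bij_betw_def inv_into_into f_inv_into_f simp del: atLeastAtMost_iff)

lemma Diff_plus_mono_iff:
  "\<phi> \<in> Diff_plus \<Longrightarrow> s \<in> I01 \<Longrightarrow> t \<in> I01 \<Longrightarrow> \<phi> s < \<phi> t \<longleftrightarrow> s < t"
  unfolding Diff_plus_def by (auto simp: strict_mono_on_less)

text \<open>The preimage of 0 lies in the interval, hence not to the left of 0, and monotonicity
  gives \<open>\<phi> 0 \<le> 0\<close>; likewise at 1. This keeps the boundary conditions in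
  \<open>Ver\<close> and \<open>Hor\<close> stable under reparameterization.\<close>

lemma Diff_plus_endpoints:
  assumes "\<phi> \<in> Diff_plus"
  shows "\<phi> 0 = 0" "\<phi> 1 = 1"
proof -
  have "\<not> inv_into I01 \<phi> 0 < 0" "\<not> 1 < inv_into I01 \<phi> 1"
    using Diff_plus_inv(1)[OF assms, of 0] Diff_plus_inv(1)[OF assms, of 1] by auto
  then have "\<not> \<phi> (inv_into I01 \<phi> 0) < \<phi> 0" "\<not> \<phi> 1 < \<phi> (inv_into I01 \<phi> 1)"
    using Diff_plus_mono_iff[OF assms, of 0 0] Diff_plus_mono_iff[OF assms, of "inv_into I01 \<phi> 0" 0]
      Diff_plus_mono_iff[OF assms, of 1 "inv_into I01 \<phi> 1"]
      Diff_plus_inv(1)[OF assms, of 0] Diff_plus_inv(1)[OF assms, of 1] by auto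
  then show "\<phi> 0 = 0" "\<phi> 1 = 1"
    using Diff_plus_in[OF assms, of 0] Diff_plus_in[OF assms, of 1]
      Diff_plus_inv(2)[OF assms, of 0] Diff_plus_inv(2)[OF assms, of 1] by auto
qed

lemma Diff_plus_inverse:
  assumes "\<phi> \<in> Diff_plus"
  shows "inv_into I01 \<phi> \<in> Diff_plus"
proof -
  let ?\<psi> = "inv_into I01 \<phi>"
  have bij: "bij_betw ?\<psi> I01 I01"
    by (rule bij_betw_inv_into[OF Diff_plus_bij[OF assms]])
  have "strict_mono_on I01 ?\<psi>"
  proof (rule strict_mono_onI)
    fix s t :: real assume "s \<in> I01" "t \<in> I01" "s < t"
    then show "?\<psi> s < ?\<psi> t"
      using Diff_plus_mono_iff[OF assms, of "?\<psi> s" "?\<psi> t"] Diff_plus_inv[OF assms, of s]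
        Diff_plus_inv[OF assms, of t] by simp
  qed
  moreover have "smooth_on I01 (inv_into I01 ?\<psi>) \<longleftrightarrow> smooth_on I01 \<phi>"
  proof (rule smooth_on_cong)
    fix t :: real assume "t \<in> I01"
    then show "inv_into I01 ?\<psi> t = \<phi> t"
      by (rule inv_into_inv_into_eq[OF Diff_plus_bij[OF assms]])
  qed
  ultimately show ?thesis
    using assms bij unfolding Diff_plus_def by blast
qed

lemma smooth_on_I01_has_vector_derivative:
  fixes f :: "real \<Rightarrow> 'b::real_normed_vector"
  assumes "smooth_on I01 f" "t \<in> I01"
  shows "(f has_vector_derivative vector_derivative f (at t within I01)) (at t within I01)"
proof -
  obtain f' where "(f has_derivative f') (at t within I01)"
    using smooth_on_has_derivative[OF assms] .
  then have d: "(f has_vector_derivative f' 1) (at t within I01)"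
    by (rule has_derivative_vector_derivative)
  show ?thesis unfolding vector_derivative_I01[OF assms(2) d] by (rule d)
qed

text \<open>Monotonicity alone gives only a nonnegative derivative. It cannot vanish because the
  inverse is differentiable too, and the chain rule for their composition yields the product
  1.\<close>

lemma Diff_plus_derivative_pos:
  assumes "\<phi> \<in> Diff_plus" "t \<in> I01"
  shows "vector_derivative \<phi> (at t within I01) > 0"
proof -
  let ?\<psi> = "inv_into I01 \<phi>" and ?d = "vector_derivative \<phi> (at t within I01)"
  let ?e = "vector_derivative ?\<psi> (at (\<phi> t) within I01)"
  have d: "(\<phi> has_vector_derivative ?d) (at t within I01)"
    using assms by (intro smooth_on_I01_has_vector_derivative) (auto simp: Diff_plus_def)
  have e: "(?\<psi> has_vector_derivative ?e) (at (\<phi> t) within I01)"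
    using assms Diff_plus_in by (intro smooth_on_I01_has_vector_derivative) (auto simp: Diff_plus_def)
  have "((?\<psi> \<circ> \<phi>) has_vector_derivative ?d *\<^sub>R ?e) (at t within I01)"
    using Diff_plus_bij[OF assms(1)]
    by (intro vector_diff_chain_within d) (simp add: bij_betw_imp_surj_on e)
  moreover have "((?\<psi> \<circ> \<phi>) has_vector_derivative 1) (at t within I01)"
    by (rule has_vector_derivative_transform[OF assms(2) _ has_vector_derivative_id])
      (simp add: Diff_plus_inv(3)[OF assms(1)])
  ultimately have "?d *\<^sub>R ?e = 1"
    by (metis vector_derivative_I01[OF assms(2)])
  then have "?d \<noteq> 0" by auto
  moreover have "?d \<ge> 0"
  proof (rule tendsto_lowerbound)
    show "((\<lambda>r. (\<phi> r - \<phi> t) / (r - t)) \<longlongrightarrow> ?d) (at t within I01)"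
      using d by (simp add: has_real_derivative_iff_has_vector_derivative[symmetric] has_field_derivative_iff)
    show "\<forall>\<^sub>F r in at t within I01. 0 \<le> (\<phi> r - \<phi> t) / (r - t)"
      unfolding eventually_at_filter
    proof (intro always_eventually allI impI)
      fix r assume "r \<noteq> t" "r \<in> I01"
      then show "0 \<le> (\<phi> r - \<phi> t) / (r - t)"
        using Diff_plus_mono_iff[OF assms(1), of r t] Diff_plus_mono_iff[OF assms(1), of t r] assms(2)
        by (cases "r < t") (auto simp: divide_nonpos_nonpos)
    qed
    show "at t within I01 \<noteq> bot" by (rule at_within_I01[OF assms(2)])
  qed
  ultimately show ?thesis by simp
qed

lemma diff_pathD:
  assumes "diff_path \<phi>"
  shows "smooth_on (I01 \<times> I01) (\<lambda>(s, t). \<phi> s t)" "s \<in> I01 \<Longrightarrow> \<phi> s \<in> Diff_plus"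
  using assms unfolding diff_path_def by blast+

lemma diff_path_partial_t_pos:
  "diff_path \<phi> \<Longrightarrow> s \<in> I01 \<Longrightarrow> t \<in> I01 \<Longrightarrow> partial_t \<phi> s t > 0"
  using Diff_plus_derivative_pos diff_pathD(2) by blast

text \<open>Inverting \<open>(s, t) \<mapsto> (s, \<phi> s t)\<close> on the square, rather than
  every \<open>\<phi> s\<close> separately, gives joint regularity in both variables.\<close>

lemma diff_path_inverse:
  assumes \<phi>: "diff_path \<phi>"
  defines "\<psi> \<equiv> \<lambda>s. inv_into I01 (\<phi> s)"
  shows has_derivative_diff_path_inverse: "s \<in> I01 \<Longrightarrow> t \<in> I01 \<Longrightarrow>
      ((\<lambda>(s, t). (s, \<psi> s t)) has_derivative (\<lambda>v. (fst v,
        (snd v - fst v * partial_s \<phi> s (\<psi> s t)) / partial_t \<phi> s (\<psi> s t))))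
        (at (s, t) within I01 \<times> I01)"
    and smooth_on_diff_path_inverse: "smooth_on (I01 \<times> I01) (\<lambda>(s, t). \<psi> s t)"
proof -
  define \<Phi> where "\<Phi> = (\<lambda>(s, t). (s, \<phi> s t))"
  define \<Psi> where "\<Psi> = (\<lambda>(s, t). (s, \<psi> s t))"
  \<comment> \<open>The inverse of the Jacobian with rows \<open>(1, 0)\<close> and
    \<open>(partial_s \<phi>, partial_t \<phi>)\<close>, taken at the point
    \<open>\<Psi> x\<close>.\<close>
  define D where "D = (\<lambda>x v. (fst v, (snd v - fst v * (\<lambda>(s, t). partial_s \<phi> s t) (\<Psi> x))
      / (\<lambda>(s, t). partial_t \<phi> s t) (\<Psi> x)))"
  note in_diff = diff_pathD(2)[OF \<phi>]
  have \<Psi>_in: "\<Psi> ` (I01 \<times> I01) \<subseteq> I01 \<times> I01"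
    using Diff_plus_inv(1)[OF in_diff] by (force simp: \<Psi>_def \<psi>_def)
  have \<Phi>\<Psi>: "\<Phi> (\<Psi> x) = x" if "x \<in> I01 \<times> I01" for x
    using that Diff_plus_inv(2)[OF in_diff] by (auto simp: \<Psi>_def \<Phi>_def \<psi>_def)
  have \<Psi>\<Phi>: "\<Psi> (\<Phi> x) = x" if "x \<in> I01 \<times> I01" for x
    using that Diff_plus_inv(3)[OF in_diff] by (auto simp: \<Psi>_def \<Phi>_def \<psi>_def)
  have \<Phi>_in: "\<Phi> ` (I01 \<times> I01) \<subseteq> I01 \<times> I01"
    using Diff_plus_in[OF in_diff] by (force simp: \<Phi>_def)
  have im: "\<Phi> ` (I01 \<times> I01) = I01 \<times> I01"
  proof (intro equalityI \<Phi>_in subsetI)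
    fix x :: "real \<times> real" assume x: "x \<in> I01 \<times> I01"
    show "x \<in> \<Phi> ` (I01 \<times> I01)"
      by (rule image_eqI[of x \<Phi> "\<Psi> x", OF \<Phi>\<Psi>[OF x, symmetric] subsetD[OF \<Psi>_in imageI[OF x]]])
  qed
  have \<Phi>_eq: "\<Phi> = (\<lambda>x. (fst x, (\<lambda>(s, t). \<phi> s t) x))"
    by (auto simp: \<Phi>_def)
  have "continuous_on (I01 \<times> I01) \<Phi>"
    unfolding \<Phi>_eq
    by (intro continuous_on_Pair continuous_on_fst continuous_on_id smooth_on_continuous[OF diff_pathD(1)[OF \<phi>]])
  \<comment> \<open>A continuous injection on the compact square has a continuous inverse on its
    image, which is the square again.\<close>
  then have cont: "continuous_on (I01 \<times> I01) \<Psi>"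
    using continuous_on_inv[of "I01 \<times> I01" \<Phi> \<Psi>] \<Psi>\<Phi> unfolding im
    by (simp add: compact_Times)
  have deriv: "(\<Psi> has_derivative D x) (at x within I01 \<times> I01)" if x: "x \<in> I01 \<times> I01" for x
  proof -
    obtain s t where st: "\<Psi> x = (s, t)" "s \<in> I01" "t \<in> I01"
      using subsetD[OF \<Psi>_in imageI[OF x]] by (cases "\<Psi> x") auto
    note pos = diff_path_partial_t_pos[OF \<phi> st(2,3)]
    show ?thesis
    proof (rule has_derivative_inverse_within)
      show "(\<Phi> has_derivative (\<lambda>v. (fst v, fst v *\<^sub>R partial_s \<phi> s t + snd v *\<^sub>R partial_t \<phi> s t)))
          (at (\<Psi> x) within I01 \<times> I01)"
        unfolding st(1) \<Phi>_eq
        by (intro has_derivative_Pair has_derivative_fst has_derivative_ident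
            has_derivative_square[OF diff_pathD(1)[OF \<phi>]] st)
      show "bounded_linear (D x)"
        unfolding D_def
        by (intro bounded_linear_Pair bounded_linear_fst bounded_linear_sub bounded_linear_snd
            bounded_linear_mult_const bounded_linear_compose[OF bounded_linear_divide])
      show "D x (fst v, fst v *\<^sub>R partial_s \<phi> s t + snd v *\<^sub>R partial_t \<phi> s t) = v" for v
        using pos by (simp add: D_def st(1))
      show "continuous (at x within I01 \<times> I01) \<Psi>"
        using cont x unfolding continuous_on_eq_continuous_within by blast
    qed (use \<Psi>_in x \<Phi>\<Psi> in blast)+
  qed
  then show "((\<lambda>(s, t). (s, \<psi> s t)) has_derivative (\<lambda>v. (fst v,
        (snd v - fst v * partial_s \<phi> s (\<psi> s t)) / partial_t \<phi> s (\<psi> s t))))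
        (at (s, t) within I01 \<times> I01)" if "s \<in> I01" "t \<in> I01"
    using deriv[of "(s, t)"] that by (simp add: \<Psi>_def D_def)
  \<comment> \<open>\<open>D x\<close> is a rational expression in partial derivatives of
    \<open>\<phi>\<close> evaluated at \<open>\<Psi> x\<close>, with nonzero denominator. If
    \<open>\<Psi>\<close> has order \<open>k\<close>, so has its derivative, and
    \<open>\<Psi>\<close> has order \<open>k + 1\<close>.\<close>
  have "Ck_on k \<Psi> (I01 \<times> I01)" for k
  proof (induction k)
    case 0
    then show ?case using cont by simp
  next
    case (Suc k)
    have ps: "Ck_on k (\<lambda>x. (\<lambda>(s, t). partial_s \<phi> s t) (\<Psi> x)) (I01 \<times> I01)"
      using Ck_on_compose[OF _ Suc \<Psi>_in] smooth_on_partial_s[OF diff_pathD(1)[OF \<phi>]]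
      unfolding smooth_on_def by blast
    have pt: "Ck_on k (\<lambda>x. (\<lambda>(s, t). partial_t \<phi> s t) (\<Psi> x)) (I01 \<times> I01)"
      using Ck_on_compose[OF _ Suc \<Psi>_in] smooth_on_partial_t[OF diff_pathD(1)[OF \<phi>]]
      unfolding smooth_on_def by blast
    have nz: "(\<lambda>(s, t). partial_t \<phi> s t) (\<Psi> x) \<in> - {0}" if "x \<in> I01 \<times> I01" for x
    proof -
      obtain s t where "\<Psi> x = (s, t)" "s \<in> I01" "t \<in> I01"
        using subsetD[OF \<Psi>_in imageI[OF \<open>x \<in> I01 \<times> I01\<close>]] by (cases "\<Psi> x") auto
      then show ?thesis using diff_path_partial_t_pos[OF \<phi>, of s t] by simp
    qed
    have inv: "Ck_on k (\<lambda>x. inverse ((\<lambda>(s, t). partial_t \<phi> s t) (\<Psi> x))) (I01 \<times> I01)"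
      by (rule Ck_on_compose[OF Ck_on_inverse pt image_subsetI[OF nz]])
    show ?case
    proof (rule Ck_on_SucI[OF deriv])
      fix v :: "real \<times> real"
      have "Ck_on k (\<lambda>x. (fst v, (snd v + - fst v * (\<lambda>(s, t). partial_s \<phi> s t) (\<Psi> x))
          * inverse ((\<lambda>(s, t). partial_t \<phi> s t) (\<Psi> x)))) (I01 \<times> I01)"
        by (intro Ck_on_Pair Ck_on_mult Ck_on_add Ck_on_const ps inv)
      then show "Ck_on k (\<lambda>x. D x v) (I01 \<times> I01)"
        unfolding D_def divide_inverse by simp
    qed
  qed
  then have "smooth_on (I01 \<times> I01) \<Psi>" unfolding smooth_on_def by blast
  then have "smooth_on (I01 \<times> I01) (\<lambda>x. snd (\<Psi> x))"
    by (rule smooth_on_compose[OF smooth_on_bounded_linear[OF bounded_linear_snd] _ subset_UNIV])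
  then show "smooth_on (I01 \<times> I01) (\<lambda>(s, t). \<psi> s t)"
    by (simp add: \<Psi>_def case_prod_beta')
qed

text \<open>The PDE is a transport equation, and the level curves
  \<open>r \<mapsto> inv_into I01 (\<phi> r) t\<close> of one solution are its characteristics. Any
  other solution is constant along them and agrees at time 0. Since \<open>\<phi>\<close> itself
  supplies the characteristics, the coefficient \<open>a\<close> may be an arbitrary
  function.\<close>

lemma reparam_pde_unique:
  assumes \<phi>: "diff_path \<phi>" and \<phi>': "diff_path \<phi>'"
    and init: "\<And>t. t \<in> I01 \<Longrightarrow> \<phi> 0 t = t" "\<And>t. t \<in> I01 \<Longrightarrow> \<phi>' 0 t = t"
    and pde: "\<And>s t. s \<in> I01 \<Longrightarrow> t \<in> I01 \<Longrightarrow> partial_s \<phi> s t = a s t * partial_t \<phi> s t"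
      "\<And>s t. s \<in> I01 \<Longrightarrow> t \<in> I01 \<Longrightarrow> partial_s \<phi>' s t = a s t * partial_t \<phi>' s t"
    and st: "s \<in> I01" "t \<in> I01"
  shows "\<phi>' s t = \<phi> s t"
proof -
  let ?\<psi> = "\<lambda>s. inv_into I01 (\<phi> s)"
  have const: "\<phi>' s (?\<psi> s t) = t" if st: "s \<in> I01" "t \<in> I01" for s t
  proof -
    have "((\<lambda>r. \<phi>' r (?\<psi> r t)) has_derivative (\<lambda>h. 0)) (at r within I01)" if r: "r \<in> I01" for r
    proof -
      define q where "q = ?\<psi> r t"
      have q: "q \<in> I01"
        unfolding q_def by (rule Diff_plus_inv(1)[OF diff_pathD(2)[OF \<phi> r] st(2)])
      have pos: "partial_t \<phi> r q > 0" by (rule diff_path_partial_t_pos[OF \<phi> r q])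
      have "((\<lambda>(s, t). (s, ?\<psi> s t)) has_derivative (\<lambda>v. (fst v,
        (snd v - fst v * partial_s \<phi> r q) / partial_t \<phi> r q))) (at (r, t) within I01 \<times> I01)"
        unfolding q_def by (rule has_derivative_diff_path_inverse[OF \<phi> r st(2)])
      then have "((\<lambda>(s, t). (s, ?\<psi> s t)) has_derivative (\<lambda>v. (fst v,
        (snd v - fst v * partial_s \<phi> r q) / partial_t \<phi> r q))) (at (r, t) within (\<lambda>s. (s, t)) ` I01)"
        by (rule has_derivative_subset) (use st in auto)
      \<comment> \<open>Setting the second component of the direction to 0 leaves the quotient
        \<open>- partial_s \<phi> / partial_t \<phi>\<close>, which by the PDE is the speed
        \<open>- a\<close> of the characteristic.\<close>
      from has_derivative_in_compose[OF has_derivative_Pair[OF has_derivative_ident has_derivative_const] this]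
      have 1: "((\<lambda>s. (s, ?\<psi> s t)) has_derivative (\<lambda>h. (h, - (h * a r q)))) (at r within I01)"
        using pos by (simp add: pde(1)[OF r q])
      have "((\<lambda>(s, t). \<phi>' s t) has_derivative (\<lambda>v. fst v *\<^sub>R partial_s \<phi>' r q + snd v *\<^sub>R partial_t \<phi>' r q))
          (at (r, q) within I01 \<times> I01)"
        by (rule has_derivative_square[OF diff_pathD(1)[OF \<phi>'] r q])
      then have 2: "((\<lambda>(s, t). \<phi>' s t) has_derivative (\<lambda>v. fst v *\<^sub>R partial_s \<phi>' r q + snd v *\<^sub>R partial_t \<phi>' r q))
          (at (r, ?\<psi> r t) within (\<lambda>s. (s, ?\<psi> s t)) ` I01)"
        unfolding q_def
        by (rule has_derivative_subset) (use Diff_plus_inv(1)[OF diff_pathD(2)[OF \<phi>] st(2)] in force)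
      \<comment> \<open>By the PDE for \<open>\<phi>'\<close> the time derivative contributes
        \<open>a * partial_t \<phi>'\<close> and the motion along the characteristic contributes its
        negative.\<close>
      from has_derivative_in_compose[OF 1 2] show ?thesis
        by (simp add: pde(2)[OF r q])
    qed
    then obtain k where "\<forall>r\<in>I01. \<phi>' r (?\<psi> r t) = k"
      using has_derivative_zero_constant[of I01 "\<lambda>r. \<phi>' r (?\<psi> r t)"] by auto
    moreover have "\<phi>' 0 (?\<psi> 0 t) = t"
      using init Diff_plus_inv[OF diff_pathD(2)[OF \<phi>], of 0 t] st(2) by simp
    ultimately show ?thesis using st by fastforce
  qed
  \<comment> \<open>Evaluated on the characteristic that passes through \<open>t\<close> at time
    \<open>s\<close>, that is, with label \<open>\<phi> s t\<close>.\<close>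
  show ?thesis
    using const[OF st(1), of "\<phi> s t"] Diff_plus_inv(3)[OF diff_pathD(2)[OF \<phi> st(1)] st(2)]
      Diff_plus_in[OF diff_pathD(2)[OF \<phi> st(1)] st(2)] by simp
qed

section \<open>Curves in manifolds\<close>

lemma smooth_map_cong:
  fixes A :: "('a::topological_space, 'e::euclidean_space) chart set"
  assumes "\<And>x. x \<in> S \<Longrightarrow> F x = F' x"
  shows "smooth_map A S F \<longleftrightarrow> smooth_map A S F'"
proof -
  have "S \<inter> F -` U = S \<inter> F' -` U" for U using assms by auto
  moreover have "smooth_on (S \<inter> F' -` U) (\<lambda>x. chart_map \<kappa> (F x))
      \<longleftrightarrow> smooth_on (S \<inter> F' -` U) (\<lambda>x. chart_map \<kappa> (F' x))" for U and \<kappa> :: "('a, 'e) chart"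
    using assms by (intro smooth_on_cong) simp
  ultimately show ?thesis
    unfolding smooth_map_def using assms by (simp cong: continuous_on_cong)
qed

lemma smooth_map_compose:
  fixes f :: "'p::real_normed_vector \<Rightarrow> 'q::euclidean_space"
  assumes F: "smooth_map A T F" and f: "smooth_on S f" "f ` S \<subseteq> T"
  shows "smooth_map A S (\<lambda>x. F (f x))"
  unfolding smooth_map_def
proof (intro conjI ballI)
  show "continuous_on S (\<lambda>x. F (f x))"
    using F smooth_on_continuous[OF f(1)] f(2) unfolding smooth_map_def
    by (intro continuous_on_compose2[of T F S f]) auto
  fix \<kappa> assume "\<kappa> \<in> A"
  then have "smooth_on (T \<inter> F -` chart_dom \<kappa>) (\<lambda>x. chart_map \<kappa> (F x))"
    using F unfolding smooth_map_def by blast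
  then show "smooth_on (S \<inter> (\<lambda>x. F (f x)) -` chart_dom \<kappa>) (\<lambda>x. chart_map \<kappa> (F (f x)))"
    by (rule smooth_on_compose[OF _ smooth_on_subset[OF f(1)]]) (use f(2) in auto)
qed

lemma smooth_field_along_cong:
  assumes "\<And>x. x \<in> S \<Longrightarrow> F x = F' x" "\<And>x. x \<in> S \<Longrightarrow> w x = w' x"
  shows "smooth_field_along A S F w \<longleftrightarrow> smooth_field_along A S F' w'"
proof -
  have "S \<inter> F -` U = S \<inter> F' -` U" for U using assms by auto
  moreover have "smooth_on (S \<inter> F' -` U) (\<lambda>x. w x \<kappa>) \<longleftrightarrow> smooth_on (S \<inter> F' -` U) (\<lambda>x. w' x \<kappa>)" for U \<kappa>
    using assms by (intro smooth_on_cong) simp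
  ultimately show ?thesis
    unfolding smooth_field_along_def using assms by simp
qed

lemma smooth_field_along_compose:
  fixes f :: "'p::real_normed_vector \<Rightarrow> 'q::euclidean_space"
  assumes w: "smooth_field_along A T F w" and f: "smooth_on S f" "f ` S \<subseteq> T"
  shows "smooth_field_along A S (\<lambda>x. F (f x)) (\<lambda>x. w (f x))"
  unfolding smooth_field_along_def
proof (intro conjI ballI)
  show "w (f x) \<in> tangent_space A (F (f x))" if "x \<in> S" for x
    using w f(2) that unfolding smooth_field_along_def by blast
  fix \<kappa> assume "\<kappa> \<in> A"
  then have "smooth_on (T \<inter> F -` chart_dom \<kappa>) (\<lambda>x. w x \<kappa>)"
    using w unfolding smooth_field_along_def by blast
  then show "smooth_on (S \<inter> (\<lambda>x. F (f x)) -` chart_dom \<kappa>) (\<lambda>x. w (f x) \<kappa>)"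
    by (rule smooth_on_compose[where g="\<lambda>x. w x \<kappa>", OF _ smooth_on_subset[OF f(1)]]) (use f(2) in auto)
qed

lemma smooth_map_has_derivative:
  assumes "smooth_map A S F" "\<kappa> \<in> A" "x \<in> S" "F x \<in> chart_dom \<kappa>" "open (chart_dom \<kappa>)"
  obtains F' where "((\<lambda>x. chart_map \<kappa> (F x)) has_derivative F') (at x within S)"
proof -
  have "smooth_on (S \<inter> F -` chart_dom \<kappa>) (\<lambda>x. chart_map \<kappa> (F x))" "continuous_on S F"
    using assms unfolding smooth_map_def by blast+
  moreover have "x \<in> S \<inter> F -` chart_dom \<kappa>" using assms by blast
  ultimately obtain F' where "((\<lambda>x. chart_map \<kappa> (F x)) has_derivative F') (at x within (S \<inter> F -` chart_dom \<kappa>))"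
    using smooth_on_has_derivative by blast
  then show ?thesis
    using that at_within_preimage[OF \<open>continuous_on S F\<close> assms(5,3,4)] by simp
qed

lemma velocity_cong:
  assumes "\<And>r. r \<in> I01 \<Longrightarrow> c r = c' r" "t \<in> I01"
  shows "velocity A c t = velocity A c' t"
proof -
  have "vector_derivative (\<lambda>r. chart_map \<kappa> (c r)) (at t within I01)
      = vector_derivative (\<lambda>r. chart_map \<kappa> (c' r)) (at t within I01)" for \<kappa> :: "('a, 'b) chart"
    using assms by (intro vector_derivative_cong_eq always_eventually) auto
  then show ?thesis
    unfolding velocity_def using assms by auto
qed

lemma Imm_cong: "(\<And>t. t \<in> I01 \<Longrightarrow> c t = c' t) \<Longrightarrow> c \<in> Imm A \<longleftrightarrow> c' \<in> Imm A"
  unfolding Imm_def using smooth_map_cong[of I01 c c' A] velocity_cong[of c c' _ A] by auto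

lemma T_Imm_cong:
  "(\<And>t. t \<in> I01 \<Longrightarrow> c t = c' t) \<Longrightarrow> (\<And>t. t \<in> I01 \<Longrightarrow> w t = w' t) \<Longrightarrow> w \<in> T_Imm A c \<longleftrightarrow> w' \<in> T_Imm A c'"
  unfolding T_Imm_def using smooth_field_along_cong[of I01 c c' w w' A] by simp

lemma unit_tangent_cong:
  "(\<And>t. t \<in> I01 \<Longrightarrow> c t = c' t) \<Longrightarrow> t \<in> I01 \<Longrightarrow> unit_tangent A g c t = unit_tangent A g c' t"
  unfolding unit_tangent_def using velocity_cong[of c c' t A] by simp

section \<open>Tangent vectors and changes of coordinates\<close>

lemma tscale_tscale: "a *\<^sub>T (b *\<^sub>T v) = (a * b) *\<^sub>T v"
  and tscale_one: "1 *\<^sub>T v = v"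
  by (simp_all add: tscale_def)

lemma tadd_tzero: "v +\<^sub>T tzero = v"
  by (simp add: tadd_def tzero_def)

lemma tscale_cancel: "a *\<^sub>T v = b *\<^sub>T v \<longleftrightarrow> a = b \<or> v = tzero"
  by (auto simp: tscale_def tzero_def fun_eq_iff)

text \<open>The differential of the coordinate change from \<open>\<kappa>\<close> to
  \<open>\<psi>\<close>, the expression that occurs inside both \<open>tangent_space\<close> and
  \<open>chart_vector\<close>.\<close>

definition transition_diff ::
    "('a, 'e::euclidean_space) chart \<Rightarrow> ('a, 'e) chart \<Rightarrow> 'a \<Rightarrow> 'e \<Rightarrow> 'e" where
  "transition_diff \<kappa> \<psi> p = frechet_derivative (chart_map \<psi> \<circ> chart_inv \<kappa>) (at (chart_map \<kappa> p))"

lemma tangent_spaceD: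
  assumes "v \<in> tangent_space A p" "\<kappa> \<in> A" "\<psi> \<in> A" "p \<in> chart_dom \<kappa>" "p \<in> chart_dom \<psi>"
  shows "v \<psi> = transition_diff \<kappa> \<psi> p (v \<kappa>)"
  using assms unfolding tangent_space_def transition_diff_def by blast

lemma tangent_space_outside:
  "v \<in> tangent_space A p \<Longrightarrow> \<not> (\<kappa> \<in> A \<and> p \<in> chart_dom \<kappa>) \<Longrightarrow> v \<kappa> = 0"
  unfolding tangent_space_def by blast

lemma tangent_spaceI:
  assumes "\<And>\<kappa>. \<not> (\<kappa> \<in> A \<and> p \<in> chart_dom \<kappa>) \<Longrightarrow> v \<kappa> = 0"
    and "\<And>\<kappa> \<psi>. \<kappa> \<in> A \<Longrightarrow> \<psi> \<in> A \<Longrightarrow> p \<in> chart_dom \<kappa> \<Longrightarrow> p \<in> chart_dom \<psi> \<Longrightarrow>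
      v \<psi> = transition_diff \<kappa> \<psi> p (v \<kappa>)"
  shows "v \<in> tangent_space A p"
  using assms unfolding tangent_space_def transition_diff_def by blast

locale atlas =
  fixes A :: "('a::{t2_space, second_countable_topology}, 'e::euclidean_space) chart set"
  assumes atlas: "smooth_atlas A"
begin

lemma chart_open: "\<kappa> \<in> A \<Longrightarrow> open (chart_dom \<kappa>)"
  and chart_image_open: "\<kappa> \<in> A \<Longrightarrow> open (chart_map \<kappa> ` chart_dom \<kappa>)"
  and chart_homeomorphism: "\<kappa> \<in> A \<Longrightarrow>
    homeomorphism (chart_dom \<kappa>) (chart_map \<kappa> ` chart_dom \<kappa>) (chart_map \<kappa>) (chart_inv \<kappa>)"
  using atlas unfolding smooth_atlas_def by blast+

lemma chart_inv_map: "\<kappa> \<in> A \<Longrightarrow> p \<in> chart_dom \<kappa> \<Longrightarrow> chart_inv \<kappa> (chart_map \<kappa> p) = p"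
  by (rule homeomorphism_apply1[OF chart_homeomorphism])

lemma chart_covers: obtains \<kappa> where "\<kappa> \<in> A" "p \<in> chart_dom \<kappa>"
  using atlas unfolding smooth_atlas_def by blast

text \<open>Charts are homeomorphisms onto open sets, so the image of the overlap is open and the
  derivative within it is a derivative in the full sense. This is what gives
  \<open>frechet_derivative\<close> its meaning here.\<close>

lemma transition_has_derivative:
  assumes "\<kappa> \<in> A" "\<psi> \<in> A" "p \<in> chart_dom \<kappa>" "p \<in> chart_dom \<psi>"
  shows "((\<lambda>x. chart_map \<psi> (chart_inv \<kappa> x)) has_derivative transition_diff \<kappa> \<psi> p) (at (chart_map \<kappa> p))"
proof -
  let ?S = "chart_map \<kappa> ` (chart_dom \<kappa> \<inter> chart_dom \<psi>)"
  have "openin (top_of_set (chart_map \<kappa> ` chart_dom \<kappa>)) ?S"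
    using chart_open[OF assms(2)]
    by (intro homeomorphism_imp_open_map[OF chart_homeomorphism[OF assms(1)]]) auto
  then have op: "open ?S"
    using chart_image_open[OF assms(1)] openin_open_eq by blast
  have "smooth_on ?S (chart_map \<psi> \<circ> chart_inv \<kappa>)"
    using atlas assms unfolding smooth_atlas_def by blast
  moreover have p: "chart_map \<kappa> p \<in> ?S" using assms by blast
  ultimately obtain D where "((chart_map \<psi> \<circ> chart_inv \<kappa>) has_derivative D) (at (chart_map \<kappa> p) within ?S)"
    using smooth_on_has_derivative by blast
  then have "(chart_map \<psi> \<circ> chart_inv \<kappa>) differentiable (at (chart_map \<kappa> p))"
    using at_within_open[OF p op] by (auto simp: differentiable_def)
  then have "((chart_map \<psi> \<circ> chart_inv \<kappa>) has_derivative transition_diff \<kappa> \<psi> p) (at (chart_map \<kappa> p))"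
    unfolding transition_diff_def frechet_derivative_works .
  then show ?thesis by (simp add: o_def)
qed

text \<open>Wherever \<open>F\<close> stays in the domain of \<open>\<kappa>\<close>, its
  \<open>\<psi>\<close>-coordinates are the transition map applied to its
  \<open>\<kappa>\<close>-coordinates. That set is relatively open in \<open>S\<close>, so the chain
  rule there decides the derivative within \<open>S\<close>.\<close>

lemma transition_along:
  fixes F :: "'p::real_normed_vector \<Rightarrow> 'a"
  assumes "continuous_on S F" "x \<in> S" "\<kappa> \<in> A" "\<psi> \<in> A" "F x \<in> chart_dom \<kappa>" "F x \<in> chart_dom \<psi>"
    and F': "((\<lambda>x. chart_map \<kappa> (F x)) has_derivative F') (at x within S)"
  shows "((\<lambda>x. chart_map \<psi> (F x)) has_derivative (\<lambda>v. transition_diff \<kappa> \<psi> (F x) (F' v))) (at x within S)"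
proof -
  have eq: "at x within (S \<inter> F -` chart_dom \<kappa>) = at x within S"
    using assms by (intro at_within_preimage chart_open)
  have "((\<lambda>x. chart_map \<psi> (chart_inv \<kappa> (chart_map \<kappa> (F x)))) has_derivative
      (\<lambda>v. transition_diff \<kappa> \<psi> (F x) (F' v))) (at x within (S \<inter> F -` chart_dom \<kappa>))"
    by (rule has_derivative_compose[OF has_derivative_subset[OF F' Int_lower1]
          transition_has_derivative[OF assms(3-6)]])
  then have "((\<lambda>x. chart_map \<psi> (F x)) has_derivative
      (\<lambda>v. transition_diff \<kappa> \<psi> (F x) (F' v))) (at x within (S \<inter> F -` chart_dom \<kappa>))"
    by (rule has_derivative_transform[rotated 2]) (use assms(2,3,5) in \<open>auto simp: chart_inv_map\<close>)
  then show ?thesis unfolding eq .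
qed

lemma transition_cocycle:
  assumes "\<kappa> \<in> A" "\<kappa>' \<in> A" "\<psi> \<in> A" "p \<in> chart_dom \<kappa>" "p \<in> chart_dom \<kappa>'" "p \<in> chart_dom \<psi>"
  shows "transition_diff \<kappa> \<psi> p u = transition_diff \<kappa>' \<psi> p (transition_diff \<kappa> \<kappa>' p u)"
proof -
  let ?S = "chart_map \<kappa> ` chart_dom \<kappa>"
  have x: "chart_map \<kappa> p \<in> ?S" using assms by blast
  note inv = chart_inv_map[OF assms(1,4)]
  \<comment> \<open>Here \<open>transition_along\<close> is used with the parameterization
    \<open>chart_inv \<kappa>\<close> as the map into the manifold, passing from the chart
    \<open>\<kappa>'\<close> to \<open>\<psi>\<close>; uniqueness of the derivative then gives the
    cocycle rule.\<close>
  have "((\<lambda>x. chart_map \<psi> (chart_inv \<kappa> x)) has_derivative (\<lambda>v.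
      transition_diff \<kappa>' \<psi> (chart_inv \<kappa> (chart_map \<kappa> p)) (transition_diff \<kappa> \<kappa>' p v)))
      (at (chart_map \<kappa> p) within ?S)"
    by (rule transition_along[OF homeomorphism_cont2[OF chart_homeomorphism[OF assms(1)]] x assms(2,3)
        _ _ has_derivative_at_withinI[OF transition_has_derivative[OF assms(1,2,4,5)]]])
      (simp_all add: inv assms)
  then have "((\<lambda>x. chart_map \<psi> (chart_inv \<kappa> x)) has_derivative (\<lambda>v.
      transition_diff \<kappa>' \<psi> p (transition_diff \<kappa> \<kappa>' p v))) (at (chart_map \<kappa> p))"
    unfolding inv at_within_open[OF x chart_image_open[OF assms(1)]] .
  from has_derivative_unique[OF this transition_has_derivative[OF assms(1,3,4,6)]]
  show ?thesis by (rule fun_cong[symmetric])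
qed

lemma transition_linear:
  assumes "\<kappa> \<in> A" "\<psi> \<in> A" "p \<in> chart_dom \<kappa>" "p \<in> chart_dom \<psi>"
  shows "transition_diff \<kappa> \<psi> p (r *\<^sub>R u + v) = r *\<^sub>R transition_diff \<kappa> \<psi> p u + transition_diff \<kappa> \<psi> p v"
proof -
  interpret bounded_linear "transition_diff \<kappa> \<psi> p"
    by (rule has_derivative_bounded_linear[OF transition_has_derivative[OF assms]])
  show ?thesis by (simp add: add scaleR)
qed

lemma tzero_tangent: "tzero \<in> tangent_space A p"
proof (rule tangent_spaceI)
  fix \<kappa> \<psi> assume "\<kappa> \<in> A" "\<psi> \<in> A" "p \<in> chart_dom \<kappa>" "p \<in> chart_dom \<psi>"
  \<comment> \<open>This instance reads T 0 = T 0 + T 0, hence T 0 = 0.\<close>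
  from transition_linear[OF this, of 1 0 0]
  show "tzero \<psi> = transition_diff \<kappa> \<psi> p (tzero \<kappa>)" by (simp add: tzero_def)
qed (simp add: tzero_def)

lemma tscale_tadd_tangent:
  assumes "u \<in> tangent_space A p" "v \<in> tangent_space A p"
  shows "r *\<^sub>T u +\<^sub>T v \<in> tangent_space A p"
proof (rule tangent_spaceI)
  fix \<kappa> \<psi> assume *: "\<kappa> \<in> A" "\<psi> \<in> A" "p \<in> chart_dom \<kappa>" "p \<in> chart_dom \<psi>"
  from transition_linear[OF *] tangent_spaceD[OF assms(1) *] tangent_spaceD[OF assms(2) *]
  show "(r *\<^sub>T u +\<^sub>T v) \<psi> = transition_diff \<kappa> \<psi> p ((r *\<^sub>T u +\<^sub>T v) \<kappa>)"
    by (simp add: tscale_def tadd_def)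
next
  fix \<kappa> assume "\<not> (\<kappa> \<in> A \<and> p \<in> chart_dom \<kappa>)"
  then show "(r *\<^sub>T u +\<^sub>T v) \<kappa> = 0"
    using tangent_space_outside[OF assms(1)] tangent_space_outside[OF assms(2)]
    by (simp add: tscale_def tadd_def)
qed

lemma tscale_tangent: "u \<in> tangent_space A p \<Longrightarrow> r *\<^sub>T u \<in> tangent_space A p"
  using tscale_tadd_tangent[OF _ tzero_tangent, of u p r] by (simp add: tadd_tzero)

lemma chart_vector_tangent:
  assumes "\<kappa> \<in> A" "p \<in> chart_dom \<kappa>"
  shows "chart_vector A \<kappa> p u \<in> tangent_space A p"
  by (rule tangent_spaceI)
    (auto simp: chart_vector_def transition_diff_def[symmetric] intro: transition_cocycle assms)

lemma chart_vector_linear: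
  assumes "\<kappa> \<in> A" "p \<in> chart_dom \<kappa>"
  shows "chart_vector A \<kappa> p (r *\<^sub>R u + v) = r *\<^sub>T chart_vector A \<kappa> p u +\<^sub>T chart_vector A \<kappa> p v"
  by (rule ext)
    (simp add: chart_vector_def transition_diff_def[symmetric] tscale_def tadd_def transition_linear assms)

lemma tangent_chart_vector:
  assumes "\<kappa> \<in> A" "p \<in> chart_dom \<kappa>" "v \<in> tangent_space A p"
  shows "chart_vector A \<kappa> p (v \<kappa>) = v"
proof
  fix \<psi>
  show "chart_vector A \<kappa> p (v \<kappa>) \<psi> = v \<psi>"
    using tangent_spaceD[OF assms(3,1) _ assms(2), of \<psi>] tangent_space_outside[OF assms(3), of \<psi>]
    unfolding chart_vector_def transition_diff_def[symmetric]
    by (cases "\<psi> \<in> A \<and> p \<in> chart_dom \<psi>") auto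
qed

section \<open>Velocities of curves and of paths of curves\<close>

lemma velocity_chart:
  assumes "smooth_map A I01 c" "t \<in> I01" "\<kappa> \<in> A" "c t \<in> chart_dom \<kappa>"
  shows "((\<lambda>r. chart_map \<kappa> (c r)) has_vector_derivative velocity A c t \<kappa>) (at t within I01)"
proof -
  obtain D where "((\<lambda>r. chart_map \<kappa> (c r)) has_derivative D) (at t within I01)"
    using smooth_map_has_derivative[OF assms(1,3,2,4) chart_open[OF assms(3)]] .
  then have d: "((\<lambda>r. chart_map \<kappa> (c r)) has_vector_derivative D 1) (at t within I01)"
    by (rule has_derivative_vector_derivative)
  show ?thesis
    unfolding velocity_def using vector_derivative_I01[OF assms(2) d] d assms by simp
qed

lemma velocity_eqI:
  assumes "t \<in> I01" "\<And>\<kappa>. \<not> (\<kappa> \<in> A \<and> c t \<in> chart_dom \<kappa>) \<Longrightarrow> v \<kappa> = 0"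
    and "\<And>\<kappa>. \<kappa> \<in> A \<Longrightarrow> c t \<in> chart_dom \<kappa> \<Longrightarrow>
      ((\<lambda>r. chart_map \<kappa> (c r)) has_vector_derivative v \<kappa>) (at t within I01)"
  shows "velocity A c t = v"
  unfolding velocity_def using assms(2) vector_derivative_I01[OF assms(1) assms(3)] by auto

text \<open>The component in \<open>\<psi>\<close> and the transformed component in
  \<open>\<kappa>\<close> are both derivatives of the same coordinate curve, and derivatives within
  the interval are unique.\<close>

lemma velocity_tangent:
  assumes "smooth_map A I01 c" "t \<in> I01"
  shows "velocity A c t \<in> tangent_space A (c t)"
proof (rule tangent_spaceI)
  fix \<kappa> \<psi> assume *: "\<kappa> \<in> A" "\<psi> \<in> A" "c t \<in> chart_dom \<kappa>" "c t \<in> chart_dom \<psi>"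
  have "((\<lambda>r. chart_map \<psi> (c r)) has_derivative
      (\<lambda>h. transition_diff \<kappa> \<psi> (c t) (h *\<^sub>R velocity A c t \<kappa>))) (at t within I01)"
    using assms velocity_chart[OF assms *(1,3)] unfolding has_vector_derivative_def smooth_map_def
    by (intro transition_along[where F=c and \<kappa>=\<kappa> and \<psi>=\<psi>] *) simp_all
  from has_derivative_vector_derivative[OF this] velocity_chart[OF assms *(2,4)]
  show "velocity A c t \<psi> = transition_diff \<kappa> \<psi> (c t) (velocity A c t \<kappa>)"
    using vector_derivative_unique_within[OF at_within_I01[OF assms(2)]] by fastforce
qed (auto simp: velocity_def)

lemma velocity_smooth_field:
  assumes c: "smooth_map A I01 c"
  shows "smooth_field_along A I01 c (velocity A c)"
  unfolding smooth_field_along_def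
proof (intro conjI ballI velocity_tangent[OF c])
  fix \<kappa> assume \<kappa>: "\<kappa> \<in> A"
  let ?S = "I01 \<inter> c -` chart_dom \<kappa>"
  have "smooth_on ?S (\<lambda>r. chart_map \<kappa> (c r))" and cont: "continuous_on I01 c"
    using c \<kappa> unfolding smooth_map_def by blast+
  from this(1) have "smooth_on ?S (\<lambda>t. vector_derivative (\<lambda>r. chart_map \<kappa> (c r)) (at t within I01))"
    by (rule smooth_on_vector_derivative)
      (auto intro!: at_within_preimage[OF cont chart_open[OF \<kappa>]])
  then show "smooth_on ?S (\<lambda>t. velocity A c t \<kappa>)"
    by (rule smooth_on_cong[THEN iffD1, rotated]) (simp add: velocity_def \<kappa>)
qed

lemma velocity_reparam:
  assumes b: "smooth_map A I01 b" and \<phi>: "\<phi> \<in> Diff_plus" and t: "t \<in> I01"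
  shows "velocity A (\<lambda>t. b (\<phi> t)) t = vector_derivative \<phi> (at t within I01) *\<^sub>T velocity A b (\<phi> t)"
proof (rule velocity_eqI[OF t])
  note \<phi>t = Diff_plus_in[OF \<phi> t]
  fix \<kappa> assume \<kappa>: "\<kappa> \<in> A" "b (\<phi> t) \<in> chart_dom \<kappa>"
  have "(\<phi> has_vector_derivative vector_derivative \<phi> (at t within I01)) (at t within I01)"
    using \<phi> t by (intro smooth_on_I01_has_vector_derivative) (auto simp: Diff_plus_def)
  then have "(((\<lambda>t. chart_map \<kappa> (b t)) \<circ> \<phi>) has_vector_derivative
      vector_derivative \<phi> (at t within I01) *\<^sub>R velocity A b (\<phi> t) \<kappa>) (at t within I01)"
    using velocity_chart[OF b \<phi>t \<kappa>] Diff_plus_bij[OF \<phi>]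
    by (intro vector_diff_chain_within) (simp_all add: bij_betw_imp_surj_on)
  then show "((\<lambda>t. chart_map \<kappa> (b (\<phi> t))) has_vector_derivative
      (vector_derivative \<phi> (at t within I01) *\<^sub>T velocity A b (\<phi> t)) \<kappa>) (at t within I01)"
    by (simp add: o_def tscale_def)
qed (auto simp: tscale_def velocity_def)

lemma path_s_reparam:
  assumes b: "smooth_map A (I01 \<times> I01) (\<lambda>(s, t). b s t)" and \<phi>: "diff_path \<phi>"
    and s: "s \<in> I01" and t: "t \<in> I01"
  shows "path_s A (\<lambda>s t. b s (\<phi> s t)) s t =
    path_s A b s (\<phi> s t) +\<^sub>T partial_s \<phi> s t *\<^sub>T path_t A b s (\<phi> s t)"
  unfolding path_s_def path_t_def
proof (rule velocity_eqI[OF s])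
  fix \<kappa> assume \<kappa>: "\<kappa> \<in> A" "b s (\<phi> s t) \<in> chart_dom \<kappa>"
  let ?F = "\<lambda>x. chart_map \<kappa> (case x of (s, t) \<Rightarrow> b s t)"
  have in01: "\<phi> r t \<in> I01" if "r \<in> I01" for r
    by (rule Diff_plus_in[OF diff_pathD(2)[OF \<phi> that] t])
  obtain F' where F': "(?F has_derivative F') (at (s, \<phi> s t) within I01 \<times> I01)"
    using smooth_map_has_derivative[OF b \<kappa>(1) _ _ chart_open[OF \<kappa>(1)], of "(s, \<phi> s t)"]
      s in01[OF s] \<kappa>(2) by auto
  note p = partial_derivatives[OF F' s in01[OF s]]
  have v: "velocity A (\<lambda>r. b r (\<phi> s t)) s \<kappa> = F' (1, 0)" "velocity A (b s) (\<phi> s t) \<kappa> = F' (0, 1)"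
    using vector_derivative_I01[OF s p(1)] vector_derivative_I01[OF in01[OF s] p(2)] \<kappa>
    by (simp_all add: velocity_def)
  have "smooth_on I01 (\<lambda>r. (\<lambda>(s, t). \<phi> s t) (r, t))"
    by (rule smooth_on_compose[OF diff_pathD(1)[OF \<phi>]
        smooth_on_Pair[OF smooth_on_bounded_linear[OF bounded_linear_ident] smooth_on_const]]) (use t in auto)
  then have "((\<lambda>r. \<phi> r t) has_derivative (\<lambda>h. h *\<^sub>R partial_s \<phi> s t)) (at s within I01)"
    using smooth_on_I01_has_vector_derivative[OF _ s, of "\<lambda>r. \<phi> r t"] by (simp add: has_vector_derivative_def)
  then have 1: "((\<lambda>r. (r, \<phi> r t)) has_derivative (\<lambda>h. (h, h *\<^sub>R partial_s \<phi> s t))) (at s within I01)"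
    by (rule has_derivative_Pair[OF has_derivative_ident])
  \<comment> \<open>The curve \<open>r \<mapsto> (r, \<phi> r t)\<close> stays in the square, so the
    derivative within the square restricts to its image, also when \<open>s\<close> or
    \<open>t\<close> is an endpoint.\<close>
  have 2: "(?F has_derivative F') (at (s, \<phi> s t) within (\<lambda>r. (r, \<phi> r t)) ` I01)"
    by (rule has_derivative_subset[OF F']) (use in01 in blast)
  from has_derivative_vector_derivative[OF has_derivative_in_compose[OF 1 2]]
  have "((\<lambda>r. ?F (r, \<phi> r t)) has_vector_derivative F' (1, 1 *\<^sub>R partial_s \<phi> s t)) (at s within I01)" .
  then have "((\<lambda>r. chart_map \<kappa> (b r (\<phi> r t))) has_vector_derivative F' (1, partial_s \<phi> s t)) (at s within I01)"
    by simp
  then show "((\<lambda>r. chart_map \<kappa> (b r (\<phi> r t))) has_vector_derivative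
      (velocity A (\<lambda>r. b r (\<phi> s t)) s +\<^sub>T partial_s \<phi> s t *\<^sub>T velocity A (b s) (\<phi> s t)) \<kappa>) (at s within I01)"
    using p(3)[of "(1, partial_s \<phi> s t)"] by (simp add: tadd_def tscale_def v)
qed (auto simp: tadd_def tscale_def velocity_def)

lemma smooth_field_scale:
  assumes "smooth_field_along A S f w" "smooth_on S m"
  shows "smooth_field_along A S f (\<lambda>t. m t *\<^sub>T w t)"
  unfolding smooth_field_along_def
proof (intro conjI ballI)
  show "m x *\<^sub>T w x \<in> tangent_space A (f x)" if "x \<in> S" for x
    using assms(1) that unfolding smooth_field_along_def by (blast intro: tscale_tangent)
  fix \<kappa> assume "\<kappa> \<in> A"
  then have "smooth_on (S \<inter> f -` chart_dom \<kappa>) (\<lambda>x. w x \<kappa>)"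
    using assms(1) unfolding smooth_field_along_def by blast
  then show "smooth_on (S \<inter> f -` chart_dom \<kappa>) (\<lambda>x. (m x *\<^sub>T w x) \<kappa>)"
    unfolding tscale_def by (intro smooth_on_scaleR smooth_on_subset[OF assms(2) Int_lower1])
qed

end

section \<open>Vertical and horizontal vector fields\<close>

locale riemannian = atlas A
  for A :: "('a::{t2_space, second_countable_topology}, 'e::euclidean_space) chart set" +
  fixes g :: "'a \<Rightarrow> ('a, 'e) tvec \<Rightarrow> ('a, 'e) tvec \<Rightarrow> real"
  assumes riemannian: "riemannian_manifold A g"
begin

lemma g_sym: "u \<in> tangent_space A p \<Longrightarrow> v \<in> tangent_space A p \<Longrightarrow> g p u v = g p v u"
  and g_linear: "u \<in> tangent_space A p \<Longrightarrow> v \<in> tangent_space A p \<Longrightarrow> w \<in> tangent_space A p \<Longrightarrow>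
      g p (r *\<^sub>T u +\<^sub>T v) w = r * g p u w + g p v w"
  and g_pos: "u \<in> tangent_space A p \<Longrightarrow> u \<noteq> tzero \<Longrightarrow> g p u u > 0"
  and g_smooth: "\<kappa> \<in> A \<Longrightarrow> smooth_on (chart_map \<kappa> ` chart_dom \<kappa>)
        (\<lambda>x. g (chart_inv \<kappa> x) (chart_vector A \<kappa> (chart_inv \<kappa> x) e) (chart_vector A \<kappa> (chart_inv \<kappa> x) f))"
  using riemannian unfolding riemannian_manifold_def by blast+

lemma g_scale:
  assumes "u \<in> tangent_space A p" "w \<in> tangent_space A p"
  shows "g p (r *\<^sub>T u) w = r * g p u w"
proof -
  have "g p tzero w = 0"
    using g_linear[OF tzero_tangent tzero_tangent assms(2), of 1] by (simp add: tscale_one tadd_tzero)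
  then show ?thesis
    using g_linear[OF assms(1) tzero_tangent assms(2), of r] by (simp add: tadd_tzero)
qed

lemma tnorm_scale:
  assumes "u \<in> tangent_space A p" "r \<ge> 0"
  shows "tnorm g p (r *\<^sub>T u) = r * tnorm g p u"
  unfolding tnorm_def
  using assms g_scale[OF assms(1) tscale_tangent[OF assms(1)], of r r] g_scale[OF assms(1) assms(1), of r]
    g_sym[OF assms(1) tscale_tangent[OF assms(1)], of r]
  by (simp add: real_sqrt_mult)

text \<open>\<open>riemannian_manifold\<close> grants smoothness only for the metric coefficients of
  the coordinate fields, so squared lengths are written as quadratic forms with these
  coefficients.\<close>

lemma metric_in_chart:
  assumes "\<kappa> \<in> A" "p \<in> chart_dom \<kappa>" "v \<in> tangent_space A p"
  shows "g p v v = (\<Sum>i\<in>Basis. \<Sum>j\<in>Basis. (v \<kappa> \<bullet> i) * ((v \<kappa> \<bullet> j) *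
    g p (chart_vector A \<kappa> p i) (chart_vector A \<kappa> p j)))"
proof -
  note tangent = chart_vector_tangent[OF assms(1,2)]
  have expand: "g p v w = (\<Sum>i\<in>Basis. (v \<kappa> \<bullet> i) * g p (chart_vector A \<kappa> p i) w)"
    if "w \<in> tangent_space A p" for w
  proof -
    have lin: "g p (chart_vector A \<kappa> p (r *\<^sub>R u + u')) w
        = r * g p (chart_vector A \<kappa> p u) w + g p (chart_vector A \<kappa> p u') w" for r u u'
      unfolding chart_vector_linear[OF assms(1,2)] by (rule g_linear[OF tangent tangent that])
    have "g p (chart_vector A \<kappa> p 0) w = 0"
      using lin[of 1 0 0] by simp
    then have "linear (\<lambda>u. g p (chart_vector A \<kappa> p u) w)"
      using lin[of 1] lin[of _ _ 0] by (intro linearI) simp_all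
    from linear_euclidean_expansion[OF this, of "v \<kappa>"] show ?thesis
      by (simp add: tangent_chart_vector assms)
  qed
  \<comment> \<open>\<open>expand\<close> works in the first argument; symmetry brings the second
    one forward, and is used once more to restore the order of the indices.\<close>
  have "g p v v = (\<Sum>i\<in>Basis. (v \<kappa> \<bullet> i) * g p v (chart_vector A \<kappa> p i))"
    using expand[OF assms(3)] by (simp add: g_sym[OF assms(3) tangent])
  also have "\<dots> = (\<Sum>i\<in>Basis. (v \<kappa> \<bullet> i) * (\<Sum>j\<in>Basis. (v \<kappa> \<bullet> j) *
      g p (chart_vector A \<kappa> p j) (chart_vector A \<kappa> p i)))"
    by (intro sum.cong refl arg_cong2[where f="(*)"] expand[OF tangent])
  also have "\<dots> = (\<Sum>i\<in>Basis. \<Sum>j\<in>Basis. (v \<kappa> \<bullet> i) * ((v \<kappa> \<bullet> j) *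
      g p (chart_vector A \<kappa> p i) (chart_vector A \<kappa> p j)))"
    unfolding sum_distrib_left
    by (intro sum.cong refl arg_cong2[where f="(*)"] g_sym[OF tangent tangent])
  finally show ?thesis .
qed

text \<open>Near each parameter one chart covers the curve, and there the quadratic form is a finite
  sum of products of smooth functions; \<open>smooth_on_local\<close> joins the pieces. Its use is
  the smoothness of the speed, and with it of unit tangents and vertical components.\<close>

lemma smooth_on_metric:
  assumes c: "smooth_map A I01 c" and w: "smooth_field_along A I01 c w"
  shows "smooth_on I01 (\<lambda>t. g (c t) (w t) (w t))"
proof (rule smooth_on_local[OF at_within_I01])
  fix t assume t: "t \<in> I01"
  obtain \<kappa> where \<kappa>: "\<kappa> \<in> A" "c t \<in> chart_dom \<kappa>" by (rule chart_covers)
  have cont: "continuous_on I01 c"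
    and c\<kappa>: "smooth_on (I01 \<inter> c -` chart_dom \<kappa>) (\<lambda>t. chart_map \<kappa> (c t))"
    using c \<kappa>(1) unfolding smooth_map_def by blast+
  have w\<kappa>: "smooth_on (I01 \<inter> c -` chart_dom \<kappa>) (\<lambda>t. w t \<kappa>)"
    using w \<kappa>(1) unfolding smooth_field_along_def by blast
  obtain U where U: "open U" "U \<inter> I01 = c -` chart_dom \<kappa> \<inter> I01"
    using cont chart_open[OF \<kappa>(1)] unfolding continuous_on_open_invariant by blast
  let ?S = "I01 \<inter> c -` chart_dom \<kappa>"
  let ?g = "\<lambda>i j x. g (chart_inv \<kappa> x) (chart_vector A \<kappa> (chart_inv \<kappa> x) i) (chart_vector A \<kappa> (chart_inv \<kappa> x) j)"
  have "smooth_on ?S (\<lambda>t. ?g i j (chart_map \<kappa> (c t)))" for i j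
    by (rule smooth_on_compose[OF g_smooth[OF \<kappa>(1)] c\<kappa>]) auto
  then have "smooth_on ?S (\<lambda>t. \<Sum>i\<in>Basis. \<Sum>j\<in>Basis. (w t \<kappa> \<bullet> i) * ((w t \<kappa> \<bullet> j) * ?g i j (chart_map \<kappa> (c t))))"
    by (intro smooth_on_sum smooth_on_mult smooth_on_inner[OF w\<kappa> smooth_on_const])
  then have "smooth_on ?S (\<lambda>t. g (c t) (w t) (w t))"
  proof (rule smooth_on_cong[THEN iffD1, rotated])
    fix r assume r: "r \<in> ?S"
    then have "w r \<in> tangent_space A (c r)"
      using w unfolding smooth_field_along_def by blast
    then show "(\<Sum>i\<in>Basis. \<Sum>j\<in>Basis. (w r \<kappa> \<bullet> i) * ((w r \<kappa> \<bullet> j) * ?g i j (chart_map \<kappa> (c r))))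
        = g (c r) (w r) (w r)"
      using r metric_in_chart[OF \<kappa>(1), of "c r" "w r"] by (simp add: chart_inv_map[OF \<kappa>(1)])
  qed
  moreover have "?S = I01 \<inter> U" using U(2) by blast
  ultimately show "\<exists>U. open U \<and> t \<in> U \<and> smooth_on (I01 \<inter> U) (\<lambda>t. g (c t) (w t) (w t))"
    using U t \<kappa>(2) by (intro exI[of _ U]) auto
qed

section \<open>Unit tangents and reparameterization of immersions\<close>

lemma Imm_smooth: "c \<in> Imm A \<Longrightarrow> smooth_map A I01 c"
  and Imm_velocity: "c \<in> Imm A \<Longrightarrow> t \<in> I01 \<Longrightarrow> velocity A c t \<noteq> tzero"
  unfolding Imm_def by blast+

lemma speed_pos: "c \<in> Imm A \<Longrightarrow> t \<in> I01 \<Longrightarrow> tnorm g (c t) (velocity A c t) > 0"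
  unfolding tnorm_def using g_pos velocity_tangent Imm_smooth Imm_velocity by simp

lemma smooth_on_speed:
  assumes "c \<in> Imm A"
  shows "smooth_on I01 (\<lambda>t. tnorm g (c t) (velocity A c t))"
  using assms unfolding tnorm_def
  by (intro smooth_on_sqrt smooth_on_metric velocity_smooth_field Imm_smooth
      g_pos velocity_tangent Imm_velocity)

lemma velocity_unit_tangent:
  "c \<in> Imm A \<Longrightarrow> t \<in> I01 \<Longrightarrow> velocity A c t = tnorm g (c t) (velocity A c t) *\<^sub>T unit_tangent A g c t"
  using speed_pos[of c t] by (simp add: unit_tangent_def tscale_tscale tscale_one)

lemma unit_tangent_nonzero: "c \<in> Imm A \<Longrightarrow> t \<in> I01 \<Longrightarrow> unit_tangent A g c t \<noteq> tzero"
  using velocity_unit_tangent[of c t] Imm_velocity[of c t] by (auto simp: tscale_def tzero_def)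

lemma vertical_in_T_Imm:
  assumes "c \<in> Imm A" "smooth_on I01 m"
  shows "(\<lambda>t. m t *\<^sub>T unit_tangent A g c t) \<in> T_Imm A c"
  unfolding T_Imm_def unit_tangent_def mem_Collect_eq
  using assms speed_pos[OF assms(1)]
  by (intro smooth_field_scale velocity_smooth_field Imm_smooth smooth_on_divide smooth_on_const
      smooth_on_speed) fastforce+

lemma Imm_reparam:
  assumes "b \<in> Imm A" "\<phi> \<in> Diff_plus"
  shows "(\<lambda>t. b (\<phi> t)) \<in> Imm A"
proof -
  have "smooth_map A I01 (\<lambda>t. b (\<phi> t))"
    using assms Diff_plus_in
    by (intro smooth_map_compose[OF Imm_smooth[OF assms(1)]]) (auto simp: Diff_plus_def bij_betw_def)
  moreover have "velocity A (\<lambda>t. b (\<phi> t)) t \<noteq> tzero" if "t \<in> I01" for t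
    using velocity_reparam[OF Imm_smooth[OF assms(1)] assms(2) that]
      Diff_plus_derivative_pos[OF assms(2) that]
      Imm_velocity[OF assms(1) Diff_plus_in[OF assms(2) that]]
    by (auto simp: tscale_def tzero_def fun_eq_iff)
  ultimately show ?thesis unfolding Imm_def by blast
qed

text \<open>The velocity and its norm are multiplied by the same factor, the derivative of
  \<open>\<phi>\<close>, which cancels because it is positive.\<close>

lemma unit_tangent_reparam:
  assumes "b \<in> Imm A" "\<phi> \<in> Diff_plus" "t \<in> I01"
  shows "unit_tangent A g (\<lambda>t. b (\<phi> t)) t = unit_tangent A g b (\<phi> t)"
  using velocity_reparam[OF Imm_smooth[OF assms(1)] assms(2,3)]
    Diff_plus_derivative_pos[OF assms(2,3)]
    tnorm_scale[OF velocity_tangent[OF Imm_smooth[OF assms(1)] Diff_plus_in[OF assms(2,3)]]]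
  by (simp add: unit_tangent_def tscale_tscale)

text \<open>Nothing is said about horizontality of \<open>b\<close>, so the formula serves both when
  \<open>b\<close> is known to be horizontal and when this is to be shown. The chain rule produces
  \<open>path_t A b\<close>, which is rewritten through \<open>c\<close> by
  \<open>path_t A c = partial_t \<phi> *\<^sub>T path_t A b\<close> at the shifted point.\<close>

lemma path_s_decomposition:
  assumes b: "imm_path A I01 b" and \<phi>: "diff_path \<phi>"
    and c: "\<And>s t. s \<in> I01 \<Longrightarrow> t \<in> I01 \<Longrightarrow> c s t = b s (\<phi> s t)"
    and s: "s \<in> I01" and t: "t \<in> I01"
  shows "path_s A c s t =
    (partial_s \<phi> s t / partial_t \<phi> s t * tnorm g (c s t) (path_t A c s t)) *\<^sub>T unit_tangent A g (c s) t
    +\<^sub>T path_s A b s (\<phi> s t)"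
proof -
  have bs: "b s \<in> Imm A" and bsm: "smooth_map A (I01 \<times> I01) (\<lambda>(s, t). b s t)"
    using b s unfolding imm_path_def by blast+
  note \<phi>s = diff_pathD(2)[OF \<phi> s]
  have cs: "c s \<in> Imm A"
    using Imm_cong[of "c s" "\<lambda>t. b s (\<phi> s t)" A] c[OF s] Imm_reparam[OF bs \<phi>s] by blast
  have "path_s A c s t = path_s A (\<lambda>s t. b s (\<phi> s t)) s t"
    unfolding path_s_def by (rule velocity_cong[OF c[OF _ t] s])
  also have "\<dots> = path_s A b s (\<phi> s t) +\<^sub>T partial_s \<phi> s t *\<^sub>T path_t A b s (\<phi> s t)"
    by (rule path_s_reparam[OF bsm \<phi> s t])
  finally have eq: "path_s A c s t = path_s A b s (\<phi> s t) +\<^sub>T partial_s \<phi> s t *\<^sub>T path_t A b s (\<phi> s t)" .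
  have "path_t A c s t = partial_t \<phi> s t *\<^sub>T path_t A b s (\<phi> s t)"
    unfolding path_t_def
    by (rule trans[OF velocity_cong[OF c[OF s] t] velocity_reparam[OF Imm_smooth[OF bs] \<phi>s t]])
  then have "path_t A b s (\<phi> s t) = (1 / partial_t \<phi> s t) *\<^sub>T path_t A c s t"
    using diff_path_partial_t_pos[OF \<phi> s t] by (simp add: tscale_tscale tscale_one)
  also have "path_t A c s t = tnorm g (c s t) (path_t A c s t) *\<^sub>T unit_tangent A g (c s) t"
    unfolding path_t_def by (rule velocity_unit_tangent[OF cs t])
  finally show ?thesis
    unfolding eq by (simp add: tscale_tscale tadd_def add.commute)
qed

end

section \<open>Vertical and horizontal fields under an invariant metric\<close>

locale invariant_metric = riemannian A g
  for A :: "('a::{t2_space, second_countable_topology}, 'e::euclidean_space) chart set"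
    and g :: "'a \<Rightarrow> ('a, 'e) tvec \<Rightarrow> ('a, 'e) tvec \<Rightarrow> real" +
  fixes G :: "(real \<Rightarrow> 'a) \<Rightarrow> (real \<Rightarrow> ('a, 'e) tvec) \<Rightarrow> (real \<Rightarrow> ('a, 'e) tvec) \<Rightarrow> real"
  assumes metric: "riemannian_metric_Imm A G"
    and invariant: "reparam_invariant A G"
begin

lemma G_cong: "c \<in> Imm A \<Longrightarrow> w \<in> T_Imm A c \<Longrightarrow> z \<in> T_Imm A c \<Longrightarrow>
      (\<And>t. t \<in> I01 \<Longrightarrow> c' t = c t \<and> w' t = w t \<and> z' t = z t) \<Longrightarrow> G c' w' z' = G c w z"
  using metric[unfolded riemannian_metric_Imm_def, THEN conjunct1, rule_format] by metis

lemma G_linear: "c \<in> Imm A \<Longrightarrow> w \<in> T_Imm A c \<Longrightarrow> y \<in> T_Imm A c \<Longrightarrow> z \<in> T_Imm A c \<Longrightarrow>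
      G c (\<lambda>t. r *\<^sub>T w t +\<^sub>T y t) z = r * G c w z + G c y z"
  by (rule metric[unfolded riemannian_metric_Imm_def, THEN conjunct2, THEN conjunct2, THEN conjunct1,
      rule_format])

lemma G_pos: "c \<in> Imm A \<Longrightarrow> w \<in> T_Imm A c \<Longrightarrow> t \<in> I01 \<Longrightarrow> w t \<noteq> tzero \<Longrightarrow> G c w w > 0"
  using metric[unfolded riemannian_metric_Imm_def, THEN conjunct2, THEN conjunct2, THEN conjunct2,
      THEN conjunct1, rule_format] by blast

text \<open>Unit tangents correspond under \<phi>, so a vertical test field along the new curve is
  the pullback of one along \<open>b\<close>, and invariance equates the two pairings. Only values
  on the interval are prescribed for \<open>b'\<close> and \<open>h'\<close>, so that the lemma
  applies to curves not literally written as compositions.\<close>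

lemma Hor_reparam:
  assumes b: "b \<in> Imm A" and h: "h \<in> Hor A g G b" and \<phi>: "\<phi> \<in> Diff_plus"
    and b': "\<And>t. t \<in> I01 \<Longrightarrow> b' t = b (\<phi> t)" and h': "\<And>t. t \<in> I01 \<Longrightarrow> h' t = h (\<phi> t)"
  shows "h' \<in> Hor A g G b'"
  unfolding Hor_def
proof (intro CollectI conjI allI impI)
  have hT: "h \<in> T_Imm A b" using h unfolding Hor_def by blast
  have b\<phi>: "(\<lambda>t. b (\<phi> t)) \<in> Imm A" by (rule Imm_reparam[OF b \<phi>])
  have \<phi>_sm: "smooth_on I01 \<phi>" "\<phi> ` I01 \<subseteq> I01"
    using \<phi> by (auto simp: Diff_plus_def bij_betw_def)
  have h\<phi>: "(\<lambda>t. h (\<phi> t)) \<in> T_Imm A (\<lambda>t. b (\<phi> t))"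
    using hT unfolding T_Imm_def mem_Collect_eq by (rule smooth_field_along_compose[OF _ \<phi>_sm])
  then show "h' \<in> T_Imm A b'"
    using T_Imm_cong[of b' "\<lambda>t. b (\<phi> t)" h' "\<lambda>t. h (\<phi> t)" A] b' h' by blast
  fix m :: "real \<Rightarrow> real" assume m: "smooth_on I01 m \<and> m 0 = 0 \<and> m 1 = 0"
  let ?\<psi> = "inv_into I01 \<phi>"
  note \<psi> = Diff_plus_inverse[OF \<phi>]
  \<comment> \<open>The test field with coefficient \<open>m\<close> is pushed forward to
    \<open>b\<close>; its coefficient still vanishes at 0 and 1 because the inverse of
    \<open>\<phi>\<close> fixes the endpoints.\<close>
  let ?z = "\<lambda>t. m (?\<psi> t) *\<^sub>T unit_tangent A g b t"
  have m\<psi>: "smooth_on I01 (\<lambda>t. m (?\<psi> t))"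
    using m \<psi> by (intro smooth_on_compose[of I01 m I01 ?\<psi>]) (auto simp: Diff_plus_def bij_betw_def)
  have Gz: "G b h ?z = 0"
    using h m\<psi> m Diff_plus_endpoints[OF \<psi>] unfolding Hor_def by simp
  have "G (b \<circ> \<phi>) (h \<circ> \<phi>) (?z \<circ> \<phi>) = G b h ?z"
    by (rule invariant[unfolded reparam_invariant_def, rule_format, OF b hT vertical_in_T_Imm[OF b m\<psi>] \<phi>])
  then have 0: "G (\<lambda>t. b (\<phi> t)) (\<lambda>t. h (\<phi> t)) (\<lambda>t. ?z (\<phi> t)) = 0"
    unfolding Gz o_def .
  have eq: "?z (\<phi> t) = m t *\<^sub>T unit_tangent A g b' t" if "t \<in> I01" for t
    using unit_tangent_reparam[OF b \<phi> that]
      unit_tangent_cong[where A=A and g=g and c=b' and c'="\<lambda>t. b (\<phi> t)", OF b' that]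
      Diff_plus_inv(3)[OF \<phi> that] by simp
  have "(\<lambda>t. ?z (\<phi> t)) \<in> T_Imm A (\<lambda>t. b (\<phi> t))"
    using vertical_in_T_Imm[OF b m\<psi>] unfolding T_Imm_def mem_Collect_eq
    by (rule smooth_field_along_compose[OF _ \<phi>_sm])
  then have "G b' h' (\<lambda>t. m t *\<^sub>T unit_tangent A g b' t)
      = G (\<lambda>t. b (\<phi> t)) (\<lambda>t. h (\<phi> t)) (\<lambda>t. ?z (\<phi> t))"
    using b' h' eq by (intro G_cong[OF b\<phi> h\<phi>]) simp_all
  with 0 show "G b' h' (\<lambda>t. m t *\<^sub>T unit_tangent A g b' t) = 0" by simp
qed

text \<open>The difference of two vertical parts of \<open>w\<close> is also a difference of
  horizontal fields. It is orthogonal to itself and vanishes by positivity of \<open>G\<close>;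
  nonvanishing unit tangents carry this over to the coefficients.\<close>

lemma vertical_component_unique:
  assumes c: "c \<in> Imm A"
    and w: "vertical_part A g G c w (\<lambda>t. m t *\<^sub>T unit_tangent A g c t)"
    and m': "smooth_on I01 m'" "m' 0 = 0" "m' 1 = 0" and h': "h' \<in> Hor A g G c"
    and eq: "\<And>t. t \<in> I01 \<Longrightarrow> w t = m' t *\<^sub>T unit_tangent A g c t +\<^sub>T h' t"
    and t: "t \<in> I01"
  shows "m t = m' t"
proof (rule ccontr)
  let ?v = "unit_tangent A g c"
  \<comment> \<open>\<open>Ver\<close> yields smoothness and boundary values only for some
    coefficient \<open>n\<close> of the same field; \<open>n\<close> and \<open>m\<close> agree on
    the interval since the unit tangent is nonzero.\<close>
  obtain n where n: "smooth_on I01 n" "n 0 = 0" "n 1 = 0" "\<forall>t\<in>I01. m t *\<^sub>T ?v t = n t *\<^sub>T ?v t"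
    using w unfolding vertical_part_def Ver_def by blast
  obtain h where h: "h \<in> Hor A g G c" "\<forall>t\<in>I01. w t = m t *\<^sub>T ?v t +\<^sub>T h t"
    using w unfolding vertical_part_def by blast
  have mn: "m r = n r" if "r \<in> I01" for r
    using n(4) that unit_tangent_nonzero[OF c that] by (auto simp: tscale_cancel)
  \<comment> \<open>The difference of the two coefficients. The field \<open>?z\<close> built from
    it is vertical by construction and equals \<open>h'\<close> minus \<open>h\<close> on the
    interval.\<close>
  define k where "k = (\<lambda>t. n t + - 1 * m' t)"
  have k: "smooth_on I01 k" "k 0 = 0" "k 1 = 0"
    unfolding k_def
    by (intro smooth_on_add n(1) smooth_on_mult[OF smooth_on_const m'(1)]) (simp_all add: n m')
  let ?z = "\<lambda>t. k t *\<^sub>T ?v t"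
  have z: "?z \<in> T_Imm A c" by (rule vertical_in_T_Imm[OF c k(1)])
  have "(- 1) *\<^sub>T h r +\<^sub>T h' r = ?z r" if "r \<in> I01" for r
  proof
    fix \<kappa>
    have "m' r *\<^sub>R ?v r \<kappa> + h' r \<kappa> = n r *\<^sub>R ?v r \<kappa> + h r \<kappa>"
      using fun_cong[OF eq[OF that], of \<kappa>] h(2)[rule_format, OF that] mn[OF that]
      by (simp add: tadd_def tscale_def)
    then show "((- 1) *\<^sub>T h r +\<^sub>T h' r) \<kappa> = ?z r \<kappa>"
      by (simp add: tadd_def tscale_def k_def algebra_simps)
  qed
  then have "G c (\<lambda>r. (- 1) *\<^sub>T h r +\<^sub>T h' r) ?z = G c ?z ?z"
    by (intro G_cong[OF c z z]) simp
  moreover have "G c (\<lambda>r. (- 1) *\<^sub>T h r +\<^sub>T h' r) ?z = - 1 * G c h ?z + G c h' ?z"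
    using h(1) h' by (intro G_linear[OF c _ _ z]) (auto simp: Hor_def)
  moreover have "G c h ?z = 0" "G c h' ?z = 0"
    using h(1) h' k unfolding Hor_def by blast+
  ultimately have "G c ?z ?z = 0" by simp
  moreover assume "m t \<noteq> m' t"
  then have "?z t \<noteq> tzero"
    using mn[OF t] unit_tangent_nonzero[OF c t] by (auto simp: k_def tscale_def tzero_def fun_eq_iff)
  then have "G c ?z ?z > 0" using G_pos[OF c z t] by simp
  ultimately show False by simp
qed

end

section \<open>Horizontal parts of paths\<close>

lemma smooth_on_slice:
  assumes "smooth_on (I01 \<times> I01) (\<lambda>(s, t). f s t)" "s \<in> I01"
  shows "smooth_on I01 (f s)"
proof -
  have "smooth_on I01 (\<lambda>t. (s, t))"
    by (intro smooth_on_Pair smooth_on_const smooth_on_bounded_linear bounded_linear_ident)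
  then have "smooth_on I01 (\<lambda>t. (\<lambda>(s, t). f s t) (s, t))"
    by (rule smooth_on_compose[OF assms(1)]) (use assms(2) in auto)
  then show ?thesis by simp
qed

context invariant_metric
begin

text \<open>The decomposition of \<open>c\<close> splits its speed into a vertical and a horizontal
  field, and comparing the vertical coefficient with \<open>m\<close> is the PDE up to division by
  the speed.\<close>

lemma horizontal_decomposition_solution:
  assumes c: "imm_path A I01 c"
    and vert: "\<forall>s\<in>I01.
      vertical_part A g G (c s) (path_s A c s) (\<lambda>t. m s t *\<^sub>T unit_tangent A g (c s) t)"
    and dec: "horizontal_decomposition A g G c chor \<phi>"
  shows "reparam_solution A g c m \<phi>"
    and "s \<in> I01 \<Longrightarrow> t \<in> I01 \<Longrightarrow> chor s t = c s (inv_into I01 (\<phi> s) t)"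
proof -
  have chor: "imm_path A I01 chor" "\<And>s. s \<in> I01 \<Longrightarrow> path_s A chor s \<in> Hor A g G (chor s)"
    and \<phi>: "diff_path \<phi>" "\<And>t. t \<in> I01 \<Longrightarrow> \<phi> 0 t = t"
    and c_eq: "\<And>s t. s \<in> I01 \<Longrightarrow> t \<in> I01 \<Longrightarrow> c s t = chor s (\<phi> s t)"
    using dec unfolding horizontal_decomposition_def horizontal_path_def by blast+
  note diff = diff_pathD(2)[OF \<phi>(1)]
  have Imm: "c s \<in> Imm A" "chor s \<in> Imm A" if "s \<in> I01" for s
    using c chor(1) that unfolding imm_path_def by blast+
  show "chor s t = c s (inv_into I01 (\<phi> s) t)" if "s \<in> I01" "t \<in> I01"
    using c_eq[OF that(1) Diff_plus_inv(1)[OF diff[OF that(1)] that(2)]]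
      Diff_plus_inv(2)[OF diff[OF that(1)] that(2)] by simp
  show "reparam_solution A g c m \<phi>"
    unfolding reparam_solution_def
  proof (intro conjI \<phi>(1) ballI \<phi>(2))
    fix s t assume s: "s \<in> I01" and t: "t \<in> I01"
    \<comment> \<open>The coefficient of the unit tangent in
      \<open>path_s_decomposition\<close>.\<close>
    let ?m = "\<lambda>t. partial_s \<phi> s t / partial_t \<phi> s t * tnorm g (c s t) (path_t A c s t)"
    have "m s t = ?m t"
    proof (rule vertical_component_unique[OF Imm(1)[OF s] bspec[OF vert s]])
      show "smooth_on I01 ?m"
        unfolding path_t_def
        using diff_path_partial_t_pos[OF \<phi>(1) s]
        by (intro smooth_on_mult smooth_on_divide smooth_on_speed Imm s
            smooth_on_slice[OF smooth_on_partial_s[OF diff_pathD(1)[OF \<phi>(1)]]]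
            smooth_on_slice[OF smooth_on_partial_t[OF diff_pathD(1)[OF \<phi>(1)]]]) fastforce
      \<comment> \<open>All \<open>\<phi> r\<close> fix both endpoints, so the paths through them
        are constant and \<open>?m\<close> has the boundary values that \<open>Ver\<close>
        demands.\<close>
      have "((\<lambda>r. \<phi> r a) has_vector_derivative 0) (at s within I01)" if "a = 0 \<or> a = 1" for a
        using that by (intro has_vector_derivative_transform[OF s _ has_vector_derivative_const[of a]])
          (auto simp: Diff_plus_endpoints[OF diff])
      then have "partial_s \<phi> s 0 = 0" "partial_s \<phi> s 1 = 0"
        by (simp_all add: vector_derivative_I01[OF s])
      then show "?m 0 = 0" "?m 1 = 0" by simp_all
      show "(\<lambda>t. path_s A chor s (\<phi> s t)) \<in> Hor A g G (c s)"
        by (rule Hor_reparam[OF Imm(2)[OF s] chor(2)[OF s] diff[OF s] c_eq[OF s] refl])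
      show "path_s A c s t = ?m t *\<^sub>T unit_tangent A g (c s) t +\<^sub>T path_s A chor s (\<phi> s t)"
        if "t \<in> I01" for t
        by (rule path_s_decomposition[OF chor(1) \<phi>(1) c_eq s that])
    qed (rule t)
    then show "partial_s \<phi> s t = m s t / tnorm g (c s t) (path_t A c s t) * partial_t \<phi> s t"
      using diff_path_partial_t_pos[OF \<phi>(1) s t] speed_pos[OF Imm(1)[OF s] t]
      by (simp add: path_t_def)
  qed
qed

text \<open>The PDE makes the vertical summand of \<open>path_s_decomposition\<close> equal to the
  given vertical part of the speed. What remains on both sides is the horizontal remainder, so the
  speed of \<open>chor\<close> is that remainder transported by the inverse of
  \<open>\<phi> s\<close>.\<close>

lemma solution_horizontal_decomposition:
  assumes c: "imm_path A I01 c"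
    and vert: "\<forall>s\<in>I01.
      vertical_part A g G (c s) (path_s A c s) (\<lambda>t. m s t *\<^sub>T unit_tangent A g (c s) t)"
    and sol: "reparam_solution A g c m \<phi>"
    and chor: "\<And>s t. s \<in> I01 \<Longrightarrow> t \<in> I01 \<Longrightarrow> chor s t = c s (inv_into I01 (\<phi> s) t)"
  shows "horizontal_decomposition A g G c chor \<phi>"
proof -
  let ?\<psi> = "\<lambda>s. inv_into I01 (\<phi> s)"
  have \<phi>: "diff_path \<phi>" "\<And>t. t \<in> I01 \<Longrightarrow> \<phi> 0 t = t"
    and pde: "\<And>s t. s \<in> I01 \<Longrightarrow> t \<in> I01 \<Longrightarrow>
      partial_s \<phi> s t = m s t / tnorm g (c s t) (path_t A c s t) * partial_t \<phi> s t"
    using sol unfolding reparam_solution_def by blast+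
  note diff = diff_pathD(2)[OF \<phi>(1)]
  have Imm: "c s \<in> Imm A" if "s \<in> I01" for s
    using c that unfolding imm_path_def by blast
  have c_eq: "c s t = chor s (\<phi> s t)" if "s \<in> I01" "t \<in> I01" for s t
    using chor[OF that(1) Diff_plus_in[OF diff[OF that(1)] that(2)]]
      Diff_plus_inv(3)[OF diff[OF that(1)] that(2)] by simp
  have path: "imm_path A I01 chor"
    unfolding imm_path_def
  proof (intro conjI ballI)
    have c_smooth: "smooth_map A (I01 \<times> I01) (\<lambda>(s, t). c s t)"
      using c unfolding imm_path_def by blast
    \<comment> \<open>On the square \<open>chor\<close> is the composition of \<open>c\<close> with
      this map, so joint smoothness rests on joint smoothness of the inverse
      diffeomorphisms.\<close>
    have "smooth_on (I01 \<times> I01) (\<lambda>x. (fst x, case x of (s, t) \<Rightarrow> ?\<psi> s t))"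
      by (intro smooth_on_Pair smooth_on_bounded_linear bounded_linear_fst
          smooth_on_diff_path_inverse[OF \<phi>(1)])
    moreover have "(\<lambda>x. (fst x, case x of (s, t) \<Rightarrow> ?\<psi> s t)) ` (I01 \<times> I01) \<subseteq> I01 \<times> I01"
      using Diff_plus_inv(1)[OF diff] by force
    ultimately have "smooth_map A (I01 \<times> I01)
        (\<lambda>x. case (fst x, case x of (s, t) \<Rightarrow> ?\<psi> s t) of (s, t) \<Rightarrow> c s t)"
      by (rule smooth_map_compose[OF c_smooth])
    then show "smooth_map A (I01 \<times> I01) (\<lambda>(s, t). chor s t)"
      by (rule smooth_map_cong[THEN iffD1, rotated]) (auto simp: chor)
    show "chor s \<in> Imm A" if "s \<in> I01" for s
      using Imm_cong[of "chor s" "\<lambda>t. c s (?\<psi> s t)" A] chor[OF that]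
        Imm_reparam[OF Imm[OF that] Diff_plus_inverse[OF diff[OF that]]] by blast
  qed
  have "path_s A chor s \<in> Hor A g G (chor s)" if s: "s \<in> I01" for s
  proof -
    obtain h where h: "h \<in> Hor A g G (c s)"
      "\<forall>t\<in>I01. path_s A c s t = m s t *\<^sub>T unit_tangent A g (c s) t +\<^sub>T h t"
      using bspec[OF vert s] unfolding vertical_part_def by blast
    have h_eq: "h t = path_s A chor s (\<phi> s t)" if t: "t \<in> I01" for t
    proof -
      have "partial_s \<phi> s t / partial_t \<phi> s t * tnorm g (c s t) (path_t A c s t) = m s t"
        using pde[OF s t] diff_path_partial_t_pos[OF \<phi>(1) s t] speed_pos[OF Imm[OF s] t]
        by (simp add: path_t_def)
      then have "m s t *\<^sub>T unit_tangent A g (c s) t +\<^sub>T h t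
          = m s t *\<^sub>T unit_tangent A g (c s) t +\<^sub>T path_s A chor s (\<phi> s t)"
        using path_s_decomposition[OF path \<phi>(1) c_eq s t] h(2) t by simp
      then show ?thesis by (simp add: tadd_def fun_eq_iff)
    qed
    \<comment> \<open>Transport from \<open>c s\<close> back to \<open>chor s\<close>, hence
      \<open>Hor_reparam\<close> with the inverse of \<open>\<phi> s\<close>.\<close>
    show ?thesis
    proof (rule Hor_reparam[OF Imm[OF s] h(1) Diff_plus_inverse[OF diff[OF s]] chor[OF s]])
      fix t assume t: "t \<in> I01"
      show "path_s A chor s t = h (?\<psi> s t)"
        using h_eq[OF Diff_plus_inv(1)[OF diff[OF s] t]] Diff_plus_inv(2)[OF diff[OF s] t] by simp
    qed
  qed
  with path \<phi> c_eq show ?thesis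
    unfolding horizontal_decomposition_def horizontal_path_def by blast
qed

end

text \<open>The equivalence concerns pairs of \<open>\<phi>\<close> and \<open>chor\<close>: it
  shows both that every horizontal part has the claimed form and that every solution produces one.
  The other two clauses make "the" solution and "the" horizontal part meaningful: a solution exists,
  and horizontal parts agree on the square.\<close>

theorem proposition2:
  fixes A :: "('a::{t2_space, second_countable_topology}, 'e::euclidean_space) chart set"
    and g :: "'a \<Rightarrow> ('a, 'e) tvec \<Rightarrow> ('a, 'e) tvec \<Rightarrow> real"
    and G :: "(real \<Rightarrow> 'a) \<Rightarrow> (real \<Rightarrow> ('a, 'e) tvec) \<Rightarrow> (real \<Rightarrow> ('a, 'e) tvec) \<Rightarrow> real"
    and c :: "real \<Rightarrow> real \<Rightarrow> 'a"
    and m :: "real \<Rightarrow> real \<Rightarrow> real"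
  assumes "riemannian_manifold A g"
    and "riemannian_metric_Imm A G"
    and "reparam_invariant A G"
    and "\<forall>b\<in>Imm A. Ver_Hor_split A g G b"
    and "\<forall>b. imm_path A I01 b \<longrightarrow> (\<exists>chor. horizontal_part A g G b chor)"
    and "imm_path A I01 c"
    and "\<forall>s\<in>I01. vertical_part A g G (c s) (path_s A c s) (\<lambda>t. m s t *\<^sub>T unit_tangent A g (c s) t)"
  shows "(\<exists>\<phi>. reparam_solution A g c m \<phi>) \<and>
    (\<forall>\<phi> chor. horizontal_decomposition A g G c chor \<phi> \<longleftrightarrow>
       reparam_solution A g c m \<phi> \<and>
       (\<forall>s\<in>I01. \<forall>t\<in>I01. chor s t = c s (inv_into I01 (\<phi> s) t))) \<and>
    (\<forall>chor1 chor2. horizontal_part A g G c chor1 \<and> horizontal_part A g G c chor2 \<longrightarrow>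
       (\<forall>s\<in>I01. \<forall>t\<in>I01. chor1 s t = chor2 s t))"
proof -
  interpret invariant_metric A g G
    using assms(1-3) by unfold_locales (auto simp: riemannian_manifold_def)
  note solution = horizontal_decomposition_solution[OF assms(6,7)]
  \<comment> \<open>The witness is the path of diffeomorphisms in the decomposition of
    \<open>c\<close> that the standing assumption provides.\<close>
  have "\<exists>\<phi>. reparam_solution A g c m \<phi>"
    using assms(5,6) solution(1) unfolding horizontal_part_def by blast
  moreover have "horizontal_decomposition A g G c chor \<phi> \<longleftrightarrow>
       reparam_solution A g c m \<phi> \<and> (\<forall>s\<in>I01. \<forall>t\<in>I01. chor s t = c s (inv_into I01 (\<phi> s) t))"
    for \<phi> chor
    using solution[of chor \<phi>] solution_horizontal_decomposition[OF assms(6,7), of \<phi> chor] by blast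
  moreover have "chor1 s t = chor2 s t"
    if hp: "horizontal_part A g G c chor1" "horizontal_part A g G c chor2"
      and st: "s \<in> I01" "t \<in> I01" for chor1 chor2 s t
  proof -
    obtain \<phi>1 \<phi>2 where \<phi>: "horizontal_decomposition A g G c chor1 \<phi>1"
      "horizontal_decomposition A g G c chor2 \<phi>2"
      using hp unfolding horizontal_part_def by blast
    have eq: "\<phi>2 s r = \<phi>1 s r" if "r \<in> I01" for r
      by (rule reparam_pde_unique[where a="\<lambda>s t. m s t / tnorm g (c s t) (path_t A c s t)"])
        (use solution(1)[OF \<phi>(1)] solution(1)[OF \<phi>(2)] st that in \<open>auto simp: reparam_solution_def\<close>)
    have "\<phi>1 s \<in> Diff_plus" "\<phi>2 s \<in> Diff_plus"
      using \<phi> st unfolding horizontal_decomposition_def diff_path_def by blast+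
    note inv1 = Diff_plus_inv[OF this(1) st(2)] and inv2 = Diff_plus_inv[OF this(2)]
    \<comment> \<open>The \<open>\<phi>1 s\<close>-preimage of \<open>t\<close> is also mapped to
      \<open>t\<close> by \<open>\<phi>2 s\<close>, and injectivity identifies the
      preimages.\<close>
    have "inv_into I01 (\<phi>2 s) t = inv_into I01 (\<phi>1 s) t"
      using inv2(3)[OF inv1(1)] inv1(2) eq[OF inv1(1)] by simp
    then show ?thesis
      using solution(2)[OF \<phi>(1) st] solution(2)[OF \<phi>(2) st] by simp
  qed
  ultimately show ?thesis by blast
qed

end
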